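(* Let $B$ be a topological space and let $f:E\to X$ be a fibrewise map over $B$. Assume that either $E$ and $X$ are normal spaces, or $f$ is a closed fibrewise cofibration and $X$ is normal. Then for every integer $n\ge 0$ the following statements are equivalent: (i) $\mathrm{secat}_B(f)\le n$; (ii) the diagonal map $\Delta_{n+1}:X\to\prod^{n+1}_B X$ factors up to fibrewise homotopy through the fibrewise sectional $n$-fat wedge, i.e. there is a fibrewise map $\varphi:X\to T^n_B(f)$ with $j_n\circ\varphi\simeq_B\Delta_{n+1}$; (iii) the $n$-th fibrewise Ganea map $p_n:G^n_B(f)\to X$ admits a fibrewise homotopy section, i.e. there is a fibrewise map $\sigma:X\to G^n_B(f)$ with $p_n\circ\sigma\simeq_B \mathrm{id}_X$.
   Context: Fix a space $B$. A fibrewise space over $B$ is a space $X$ with a map $p_X:X\to B$; a fibrewise map $f:X\to Y$ is a map with $p_Yf=p_X$. The fibrewise product is $X\times_BY=\{(x,y):p_X(x)=p_Y(y)\}$ with the evident projection, and $\prod^n_BX$ is the $n$-fold fibrewise product; $\Delta_{n+1}(x)=(x,\dots,x)$. The fibrewise cylinder $I_B(X)$ is $X\times[0,1]$ with projection $(x,t)\mapsto p_X(x)$; a fibrewise homotopy is a fibrewise map $I_B(X)\to Y$, and $f\simeq_B g$ means fibrewise homotopic. A fibrewise map $j:A\to X$ is a fibrewise cofibration if for every fibrewise map $g:X\to Y$ and fibrewise homotopy $H:I_B(A)\to Y$ with $H(a,0)=gj(a)$ there is a fibrewise homotopy $\tilde H:I_B(X)\to Y$ with $\tilde H(x,0)=g(x)$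 and $\tilde H(j(a),t)=H(a,t)$; such $j$ is an embedding, and it is a closed fibrewise cofibration if $j(A)$ is closed in $X$. Fibrewise sectional category: an open set $U\subseteq X$ is fibrewise sectional for $f:E\to X$ if there is a fibrewise map $s:U\to E$ with $f\circ s\simeq_B$ the inclusion $U\hookrightarrow X$ (fibrewise homotopy of maps $U\to X$). $\mathrm{secat}_B(f)$ is the least $n$ such that $X$ is covered by $n+1$ fibrewise sectional open sets ($\infty$ if none). Fibrewise join: for fibrewise maps $h:Y\to K$, $k:Z\to K$ let $P_B(K)=\{(b,\theta)\in B\times K^{[0,1]}: p_K(\theta(s))=b\ \forall s\}$ and $E_{h,k}=\{(y,(b,\theta),z)\in Y\times P_B(K)\times Z: h(y)=\theta(0),\ k(z)=\theta(1)\}$, projecting to $b$. The fibrewise join $Y*_KZ$ is the quotient of $Y\sqcup (E_{h,k}\times[0,1])\sqcup Z$ by $(y,(b,\theta),z,0)\sim y$, $(y,(b,\theta),z,1)\sim z$, with the induced projection to $B$, together with the fibrewise map $Y*_KZ\to K$ given by $h$ on $Y$, $k$ on $Z$ and $(y,(b,\theta),z,t)\mapsto\theta(t)$ (the join map). Fibrewise sectional $n$-fat wedge: $T^0_B(f)=E$, $j_0=f$; for $n\ge1$, $j_n:T^n_B(f)\to\prod^{n+1}_BX$ is the join map of the fibrewise join of $f\times_B\mathrm{id}:E\times_B\prod^n_BX\to\prod^{n+1}_BX$ and $\mathrm{id}_X\times_Bj_{n-1}:X\times_BT^{n-1}_B(f)\to\prod^{n+1}_BX$. Fibrewise Ganea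 maps: $G^0_B(f)=E$, $p_0=f$; for $n\ge1$, $G^n_B(f)$ is the fibrewise join of $p_{n-1}:G^{n-1}_B(f)\to X$ and $f:E\to X$, and $p_n:G^n_B(f)\to X$ is its join map. *)

theory Defs
  imports "HOL-Analysis.Analysis" "HOL-Library.Extended_Nat"
begin

type_synonym ('a,'b) fws = "'a topology \<times> ('a \<Rightarrow> 'b)"

definition fw_space :: "'b topology \<Rightarrow> ('a,'b) fws \<Rightarrow> bool" where
  "fw_space B X \<longleftrightarrow> continuous_map (fst X) B (snd X)"

definition fw_map :: "('a,'b) fws \<Rightarrow> ('c,'b) fws \<Rightarrow> ('a \<Rightarrow> 'c) \<Rightarrow> bool" where
  "fw_map X Y g \<longleftrightarrow> continuous_map (fst X) (fst Y) g \<and>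
     (\<forall>x\<in>topspace (fst X). snd Y (g x) = snd X x)"

definition fw_homotopic :: "('a,'b) fws \<Rightarrow> ('c,'b) fws \<Rightarrow> ('a \<Rightarrow> 'c) \<Rightarrow> ('a \<Rightarrow> 'c) \<Rightarrow> bool" where
  "fw_homotopic X Y g g' \<longleftrightarrow>
     homotopic_with (\<lambda>h. \<forall>x\<in>topspace (fst X). snd Y (h x) = snd X x) (fst X) (fst Y) g g'"

abbreviation I01 :: "real topology" where "I01 \<equiv> top_of_set {0..1}"

definition fw_cyl :: "('a,'b) fws \<Rightarrow> ('a \<times> real,'b) fws" where
  "fw_cyl X = (prod_topology (fst X) I01, \<lambda>(x,t). snd X x)"

text \<open>Fibrewise cofibration. Test spaces range over all fibrewise spaces whose points
  live in the type ('x + 'a) \<times> real (large enough to contain the fibrewise mapping cylinder).\<close>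
definition fw_cofibration :: "'b topology \<Rightarrow> ('a,'b) fws \<Rightarrow> ('x,'b) fws \<Rightarrow> ('a \<Rightarrow> 'x) \<Rightarrow> bool" where
  "fw_cofibration B A X j \<longleftrightarrow> fw_map A X j \<and>
     (\<forall>(Y :: (('x + 'a) \<times> real) topology) pY g H.
        continuous_map Y B pY \<and> fw_map X (Y,pY) g \<and> fw_map (fw_cyl A) (Y,pY) H \<and>
        (\<forall>a\<in>topspace (fst A). H (a,0) = g (j a)) \<longrightarrow>
        (\<exists>H'. fw_map (fw_cyl X) (Y,pY) H' \<and>
              (\<forall>x\<in>topspace (fst X). H' (x,0) = g x) \<and>
              (\<forall>a\<in>topspace (fst A). \<forall>t\<in>{0..1}. H' (j a, t) = H (a,t))))"

definition closed_fw_cofibration :: "'b topology \<Rightarrow> ('a,'b) fws \<Rightarrow> ('x,'b) fws \<Rightarrow> ('a \<Rightarrow> 'x) \<Rightarrow> bool" where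
  "closed_fw_cofibration B A X j \<longleftrightarrow> fw_cofibration B A X j \<and> closedin (fst X) (j ` topspace (fst A))"

definition fw_sectional :: "('e,'b) fws \<Rightarrow> ('x,'b) fws \<Rightarrow> ('e \<Rightarrow> 'x) \<Rightarrow> 'x set \<Rightarrow> bool" where
  "fw_sectional E X f U \<longleftrightarrow> openin (fst X) U \<and>
     (\<exists>s. fw_map (subtopology (fst X) U, snd X) E s \<and>
          fw_homotopic (subtopology (fst X) U, snd X) X (f \<circ> s) id)"

definition fw_secat :: "('e,'b) fws \<Rightarrow> ('x,'b) fws \<Rightarrow> ('e \<Rightarrow> 'x) \<Rightarrow> enat" where
  "fw_secat E X f =
     (let P = (\<lambda>n::nat. \<exists>U. (\<forall>i\<le>n. fw_sectional E X f (U i)) \<and> topspace (fst X) \<subseteq> (\<Union>i\<le>n. U i))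
      in if \<exists>n. P n then enat (LEAST n. P n) else \<infinity>)"

text \<open>Fibrewise products. The n-fold fibrewise product is realised as extensional
  functions on {..<n} (n \<ge> 1).\<close>
definition fw_prod :: "('a,'b) fws \<Rightarrow> ('c,'b) fws \<Rightarrow> ('a \<times> 'c,'b) fws" where
  "fw_prod X Y = (subtopology (prod_topology (fst X) (fst Y)) {(x,y). snd X x = snd Y y},
                  \<lambda>(x,y). snd X x)"

definition fw_power :: "nat \<Rightarrow> ('x,'b) fws \<Rightarrow> (nat \<Rightarrow> 'x,'b) fws" where
  "fw_power n X = (subtopology (product_topology (\<lambda>_. fst X) {..<n})
                      {xs. \<forall>i<n. \<forall>j<n. snd X (xs i) = snd X (xs j)},
                   \<lambda>xs. snd X (xs 0))"

definition fw_diag :: "nat \<Rightarrow> 'x \<Rightarrow> (nat \<Rightarrow> 'x)" where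
  "fw_diag n x = (\<lambda>i\<in>{..<n}. x)"

text \<open>Identification X \<times>_B \<Prod>^n_B X = \<Prod>^{n+1}_B X (new factor in front).\<close>
definition fw_cons :: "nat \<Rightarrow> 'x \<Rightarrow> (nat \<Rightarrow> 'x) \<Rightarrow> (nat \<Rightarrow> 'x)" where
  "fw_cons n x xs = (\<lambda>i\<in>{..<Suc n}. if i = 0 then x else xs (i - 1))"

definition compact_open :: "'k topology \<Rightarrow> (real \<Rightarrow> 'k) topology" where
  "compact_open K = topology_generated_by
     {{\<theta>. \<theta> ` C \<subseteq> U} | C U. compactin I01 C \<and> openin K U}"

definition fw_paths :: "'b topology \<Rightarrow> ('k,'b) fws \<Rightarrow> ('b \<times> (real \<Rightarrow> 'k)) topology" where
  "fw_paths B K = subtopology (prod_topology B (compact_open (fst K)))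
     {(b,\<theta>). \<theta> \<in> extensional {0..1} \<and> continuous_map I01 (fst K) \<theta> \<and>
             (\<forall>s\<in>{0..1}. snd K (\<theta> s) = b)}"

definition fw_Ehk :: "'b topology \<Rightarrow> ('y,'b) fws \<Rightarrow> ('z,'b) fws \<Rightarrow> ('k,'b) fws \<Rightarrow>
    ('y \<Rightarrow> 'k) \<Rightarrow> ('z \<Rightarrow> 'k) \<Rightarrow> ('y \<times> ('b \<times> (real \<Rightarrow> 'k)) \<times> 'z) topology" where
  "fw_Ehk B Y Z K h k = subtopology (prod_topology (fst Y) (prod_topology (fw_paths B K) (fst Z)))
     {(y,(b,\<theta>),z). h y = \<theta> 0 \<and> k z = \<theta> 1}"

text \<open>Fibrewise join. Points of Y *_K Z are represented in a type 'u via injective,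
  pairwise disjoint constructors inl, inr, mid: the equivalence classes of the quotient
  are represented by inl y, inr z and mid y b \<theta> z t (0 < t < 1).\<close>
definition fw_join_q :: "('y \<Rightarrow> 'u) \<Rightarrow> ('z \<Rightarrow> 'u) \<Rightarrow> ('y \<Rightarrow> 'b \<Rightarrow> (real \<Rightarrow> 'k) \<Rightarrow> 'z \<Rightarrow> real \<Rightarrow> 'u) \<Rightarrow>
    'y \<times> ('b \<times> (real \<Rightarrow> 'k)) \<times> 'z \<Rightarrow> real \<Rightarrow> 'u" where
  "fw_join_q inl inr mid w t = (case w of (y,(b,\<theta>),z) \<Rightarrow>
      if t = 0 then inl y else if t = 1 then inr z else mid y b \<theta> z t)"

definition fw_join :: "'b topology \<Rightarrow> ('y,'b) fws \<Rightarrow> ('z,'b) fws \<Rightarrow> ('k,'b) fws \<Rightarrow>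
    ('y \<Rightarrow> 'k) \<Rightarrow> ('z \<Rightarrow> 'k) \<Rightarrow>
    ('y \<Rightarrow> 'u) \<Rightarrow> ('z \<Rightarrow> 'u) \<Rightarrow> ('y \<Rightarrow> 'b \<Rightarrow> (real \<Rightarrow> 'k) \<Rightarrow> 'z \<Rightarrow> real \<Rightarrow> 'u) \<Rightarrow>
    'u topology \<times> ('u \<Rightarrow> 'b) \<times> ('u \<Rightarrow> 'k)" where
  "fw_join B Y Z K h k inl inr mid =
    (let EE = fw_Ehk B Y Z K h k;
         C = inl ` topspace (fst Y) \<union> inr ` topspace (fst Z) \<union>
             (\<lambda>(w,t). fw_join_q inl inr mid w t) ` (topspace EE \<times> {0..1})
     in (topology (\<lambda>U. U \<subseteq> C \<and>
            openin (fst Y) {y \<in> topspace (fst Y). inl y \<in> U} \<and>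
            openin (fst Z) {z \<in> topspace (fst Z). inr z \<in> U} \<and>
            openin (prod_topology EE I01)
              {p \<in> topspace (prod_topology EE I01). fw_join_q inl inr mid (fst p) (snd p) \<in> U}),
         \<lambda>u. THE c. (\<exists>y\<in>topspace (fst Y). u = inl y \<and> c = snd Y y) \<or>
                    (\<exists>z\<in>topspace (fst Z). u = inr z \<and> c = snd Z z) \<or>
                    (\<exists>y b \<theta> z t. (y,(b,\<theta>),z) \<in> topspace EE \<and> 0 < t \<and> t < 1 \<and>
                        u = mid y b \<theta> z t \<and> c = b),
         \<lambda>u. THE c. (\<exists>y\<in>topspace (fst Y). u = inl y \<and> c = h y) \<or>
                    (\<exists>z\<in>topspace (fst Z). u = inr z \<and> c = k z) \<or>
                    (\<exists>y b \<theta> z t. (y,(b,\<theta>),z) \<in> topspace EE \<and> 0 < t \<and> t < 1 \<and>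
                        u = mid y b \<theta> z t \<and> c = \<theta> t)))"

definition final_top :: "'a topology \<Rightarrow> ('a \<Rightarrow> 'c) \<Rightarrow> 'c topology" where
  "final_top X g = topology (\<lambda>U. U \<subseteq> g ` topspace X \<and> openin X {x \<in> topspace X. g x \<in> U})"

datatype ('e,'b,'x) gpt = GE 'e | GL "('e,'b,'x) gpt" | GM "('e,'b,'x) gpt" 'b "real \<Rightarrow> 'x" 'e real

primrec fw_ganea :: "'b topology \<Rightarrow> ('e,'b) fws \<Rightarrow> ('x,'b) fws \<Rightarrow> ('e \<Rightarrow> 'x) \<Rightarrow> nat \<Rightarrow>
    ('e,'b,'x) gpt topology \<times> (('e,'b,'x) gpt \<Rightarrow> 'b) \<times> (('e,'b,'x) gpt \<Rightarrow> 'x)" where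
  "fw_ganea B E X f 0 =
     (final_top (fst E) GE,
      \<lambda>u. case u of GE e \<Rightarrow> snd E e | _ \<Rightarrow> undefined,
      \<lambda>u. case u of GE e \<Rightarrow> f e | _ \<Rightarrow> undefined)"
| "fw_ganea B E X f (Suc n) =
     (case fw_ganea B E X f n of (G, pG, p) \<Rightarrow> fw_join B (G, pG) E X p f GL GE GM)"

definition ganea_space :: "'b topology \<Rightarrow> ('e,'b) fws \<Rightarrow> ('x,'b) fws \<Rightarrow> ('e \<Rightarrow> 'x) \<Rightarrow> nat \<Rightarrow>
    (('e,'b,'x) gpt, 'b) fws" where
  "ganea_space B E X f n = (fst (fw_ganea B E X f n), fst (snd (fw_ganea B E X f n)))"

definition ganea_map :: "'b topology \<Rightarrow> ('e,'b) fws \<Rightarrow> ('x,'b) fws \<Rightarrow> ('e \<Rightarrow> 'x) \<Rightarrow> nat \<Rightarrow>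
    ('e,'b,'x) gpt \<Rightarrow> 'x" where
  "ganea_map B E X f n = snd (snd (fw_ganea B E X f n))"

text \<open>Fibrewise sectional fat wedges T^n_B(f) with j_n : T^n_B(f) \<rightarrow> \<Prod>^{n+1}_B X.
  For n = 0, \<Prod>^1_B X is identified with X, so j_0 = f under this identification.\<close>
datatype ('e,'b,'x) wpt = W0 'e | WL "'e \<times> (nat \<Rightarrow> 'x)" | WR "'x \<times> ('e,'b,'x) wpt"
  | WM "'e \<times> (nat \<Rightarrow> 'x)" 'b "real \<Rightarrow> nat \<Rightarrow> 'x" "'x \<times> ('e,'b,'x) wpt" real

primrec fw_fatwedge :: "'b topology \<Rightarrow> ('e,'b) fws \<Rightarrow> ('x,'b) fws \<Rightarrow> ('e \<Rightarrow> 'x) \<Rightarrow> nat \<Rightarrow>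
    ('e,'b,'x) wpt topology \<times> (('e,'b,'x) wpt \<Rightarrow> 'b) \<times> (('e,'b,'x) wpt \<Rightarrow> (nat \<Rightarrow> 'x))" where
  "fw_fatwedge B E X f 0 =
     (final_top (fst E) W0,
      \<lambda>u. case u of W0 e \<Rightarrow> snd E e | _ \<Rightarrow> undefined,
      \<lambda>u. case u of W0 e \<Rightarrow> (\<lambda>i\<in>{..<1}. f e) | _ \<Rightarrow> undefined)"
| "fw_fatwedge B E X f (Suc n) =
     (case fw_fatwedge B E X f n of (T, pT, j) \<Rightarrow>
        fw_join B (fw_prod E (fw_power (Suc n) X)) (fw_prod X (T, pT)) (fw_power (Suc (Suc n)) X)
          (\<lambda>(e,xs). fw_cons (Suc n) (f e) xs) (\<lambda>(x,w). fw_cons (Suc n) x (j w)) WL WR WM)"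

definition fatwedge_space :: "'b topology \<Rightarrow> ('e,'b) fws \<Rightarrow> ('x,'b) fws \<Rightarrow> ('e \<Rightarrow> 'x) \<Rightarrow> nat \<Rightarrow>
    (('e,'b,'x) wpt, 'b) fws" where
  "fatwedge_space B E X f n = (fst (fw_fatwedge B E X f n), fst (snd (fw_fatwedge B E X f n)))"

definition fatwedge_map :: "'b topology \<Rightarrow> ('e,'b) fws \<Rightarrow> ('x,'b) fws \<Rightarrow> ('e \<Rightarrow> 'x) \<Rightarrow> nat \<Rightarrow>
    ('e,'b,'x) wpt \<Rightarrow> (nat \<Rightarrow> 'x)" where
  "fatwedge_map B E X f n = snd (snd (fw_fatwedge B E X f n))"

end

theory Submission
  imports Defs
begin

text \<open>
  Say that a map \<open>g : A \<rightarrow> K\<close> lifts along \<open>h : Y \<rightarrow> K\<close> if \<open>g\<close> factors through \<open>h\<close> up to fibrewise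
  homotopy. If \<open>g\<close> lifts along the join map of \<open>h : Y \<rightarrow> K\<close> and \<open>k : Z \<rightarrow> K\<close>, then \<open>A\<close> is the union of
  two open sets on which \<open>g\<close> lifts along \<open>h\<close> and \<open>k\<close> respectively: pull back the complements of the
  two ends of the join, each of which deforms onto the other end. Conversely, two such open sets
  together with a real function separating their complements give a lift to the join: use the function
  as join coordinate and the concatenation of the two homotopies as path. Lifting the diagonal
  along \<open>f \<times> id\<close> amounts to lifting the identity along \<open>f\<close>, and lifting it along \<open>id \<times> j\<^sub>n\<close> amounts to lifting the
  shorter diagonal along \<open>j\<^sub>n\<close>. Hence in both the Ganea and the fat wedge construction a lift unwinds into a
  cover of \<open>X\<close> by \<open>n + 1\<close> sectional open sets. To rebuild a lift from a cover one needs separating functions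
  on the intermediate unions, which need not be normal; the construction therefore proceeds over closed subsets of \<open>X\<close>, which are.
\<close>

section \<open>Paths and fibrewise homotopies\<close>

lemma continuous_map_comp2:
  "continuous_map X Y g \<Longrightarrow> continuous_map Y Z f \<Longrightarrow> continuous_map X Z (\<lambda>x. f (g x))"
  using continuous_map_compose[of X Y g Z f] by (simp add: o_def)

lemma continuous_map_I01:
  "continuous_map A I01 \<tau> \<longleftrightarrow> continuous_map A euclideanreal \<tau> \<and> (\<forall>a\<in>topspace A. 0 \<le> \<tau> a \<and> \<tau> a \<le> 1)"
  by (auto simp: continuous_map_in_subtopology image_subset_iff)

lemma continuous_map_fst_snd_I01:
  "continuous_map (prod_topology A I01) euclideanreal snd"
  "continuous_map (prod_topology I01 A) euclideanreal fst"
  using continuous_map_snd[of A I01] continuous_map_fst[of I01 A] by (auto simp: continuous_map_I01)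

section \<open>The compact-open topology on paths: evaluation and currying\<close>

text \<open>The subbasic set given by the empty compact set is everything, so discontinuous
  functions are points as well; continuity of paths is imposed only in
  \<open>fw_paths\<close>.\<close>

lemma topspace_compact_open [simp]: "topspace (compact_open K) = UNIV"
proof -
  have "UNIV \<in> {{\<theta>. \<theta> ` C \<subseteq> U} | C U. compactin I01 C \<and> openin K U}"
    by (rule CollectI, rule exI[of _ "{}"], rule exI[of _ "{}"]) auto
  then show ?thesis unfolding compact_open_def topology_generated_by_topspace by blast
qed

lemma openin_compact_open:
  "compactin I01 C \<Longrightarrow> openin K U \<Longrightarrow> openin (compact_open K) {\<theta>. \<theta> ` C \<subseteq> U}"
  unfolding compact_open_def by (rule topology_generated_by_Basis) blast

text \<open>Joint continuity of evaluation rests on local compactness of the interval: some compact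
  neighbourhood of \<open>\<tau> a\<close> is still mapped into \<open>U\<close> by
  \<open>F a\<close>. Continuity of each \<open>F a\<close> is a separate assumption because
  \<open>compact_open\<close> also contains discontinuous functions.\<close>

lemma continuous_map_eval:
  assumes F: "continuous_map A (compact_open K) F" and \<tau>: "continuous_map A I01 \<tau>"
    and FK: "\<And>a. a \<in> topspace A \<Longrightarrow> continuous_map I01 K (F a)"
  shows "continuous_map A K (\<lambda>a. F a (\<tau> a))"
  unfolding continuous_map
proof (intro conjI allI impI)
  have \<tau>01: "\<tau> a \<in> {0..1}" if "a \<in> topspace A" for a
    using \<tau> that by (auto simp: continuous_map_I01)
  then show "(\<lambda>a. F a (\<tau> a)) ` topspace A \<subseteq> topspace K"
    using FK continuous_map_image_subset_topspace by fastforce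
  fix U assume U: "openin K U"
  show "openin A {a \<in> topspace A. F a (\<tau> a) \<in> U}"
  proof (subst openin_subopen, safe)
    fix a assume a: "a \<in> topspace A" and aU: "F a (\<tau> a) \<in> U"
    have "openin I01 {s \<in> {0..1}. F a s \<in> U}"
      using openin_continuous_map_preimage[OF FK[OF a] U] by simp
    then obtain e where e: "e > 0" "\<And>s. s \<in> {0..1} \<Longrightarrow> dist s (\<tau> a) < e \<Longrightarrow> F a s \<in> U"
      unfolding openin_euclidean_subtopology_iff using aU \<tau>01[OF a] by (smt (verit) mem_Collect_eq)
    \<comment> \<open>The closed ball of half the radius stays inside the open ball on which
      \<open>F a\<close> takes values in \<open>U\<close>.\<close>
    define C where "C = cball (\<tau> a) (e/2) \<inter> {0..1}"
    have C: "compactin I01 C" "\<And>s. s \<in> C \<Longrightarrow> F a s \<in> U"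
      unfolding C_def using e by (auto simp: compactin_subtopology compact_Int dist_commute)
    have \<tau>r: "continuous_map A euclideanreal \<tau>" using \<tau> by (simp add: continuous_map_I01)
    have "openin A ({x \<in> topspace A. F x \<in> {\<theta>. \<theta> ` C \<subseteq> U}} \<inter> {x \<in> topspace A. \<tau> x \<in> ball (\<tau> a) (e/2)})"
      (is "openin A ?T")
      by (intro openin_Int openin_continuous_map_preimage[OF F openin_compact_open[OF C(1) U]]
          openin_continuous_map_preimage[OF \<tau>r]) auto
    moreover have "a \<in> ?T" using a C(2) e by auto
    moreover have "?T \<subseteq> {a \<in> topspace A. F a (\<tau> a) \<in> U}"
    proof clarify
      fix x assume x: "x \<in> topspace A" "F x ` C \<subseteq> U" "\<tau> x \<in> ball (\<tau> a) (e/2)"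
      then have "\<tau> x \<in> C" using \<tau>01 by (auto simp: C_def)
      then show "F x (\<tau> x) \<in> U" using x by blast
    qed
    ultimately show "\<exists>T. openin A T \<and> a \<in> T \<and> T \<subseteq> {a \<in> topspace A. F a (\<tau> a) \<in> U}" by blast
  qed
qed

text \<open>The tube lemma does the work: if the slice over \<open>a\<close> sends \<open>C\<close>
  into \<open>U\<close>, so do all slices over a neighbourhood of \<open>a\<close>. Restriction to
  the unit interval makes the paths extensional, as \<open>fw_paths\<close> demands.\<close>

lemma continuous_map_curry:
  assumes G: "continuous_map (prod_topology A I01) K G"
  shows "continuous_map A (compact_open K) (\<lambda>a. \<lambda>s\<in>{0..1}. G (a,s))"
  unfolding compact_open_def
proof (rule continuous_on_generated_topo)
  show "(\<lambda>a. \<lambda>s\<in>{0..1}. G (a, s)) ` topspace A \<subseteq>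
      \<Union> {{\<theta>. \<theta> ` C \<subseteq> U} |C U. compactin I01 C \<and> openin K U}"
    using topspace_compact_open[of K]
    unfolding compact_open_def topology_generated_by_topspace by blast
next
  fix S assume "S \<in> {{\<theta>. \<theta> ` C \<subseteq> U} |C U. compactin I01 C \<and> openin K U}"
  then obtain C U where S: "S = {\<theta>. \<theta> ` C \<subseteq> U}" and C: "compactin I01 C" and U: "openin K U"
    by blast
  have C01: "C \<subseteq> {0..1}" using C compactin_subset_topspace by fastforce
  let ?W = "{p \<in> topspace (prod_topology A I01). G p \<in> U}"
  have W: "openin (prod_topology A I01) ?W" by (rule openin_continuous_map_preimage[OF G U])
  show "openin A ((\<lambda>a. \<lambda>s\<in>{0..1}. G (a, s)) -` S \<inter> topspace A)" (is "openin A ?P")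
  proof (subst openin_subopen, safe)
    fix a assume a: "(\<lambda>s\<in>{0..1}. G (a, s)) \<in> S" "a \<in> topspace A"
    have "{a} \<times> C \<subseteq> ?W"
    proof clarify
      fix s assume s: "s \<in> C"
      then have "s \<in> {0..1}" using C01 by blast
      moreover have "(\<lambda>s\<in>{0..1}. G (a, s)) s \<in> U" using s a S by blast
      ultimately show "(a, s) \<in> topspace (prod_topology A I01) \<and> G (a, s) \<in> U"
        using a by simp
    qed
    from tube_lemma_right[OF W C a(2) this] obtain P Q
      where PQ: "openin A P" "a \<in> P" "C \<subseteq> Q" "P \<times> Q \<subseteq> ?W" by blast
    have "P \<subseteq> ?P" unfolding S using PQ C01 openin_subset[OF PQ(1)] by auto
    then show "\<exists>T. openin A T \<and> a \<in> T \<and> T \<subseteq> ?P" using PQ by blast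
  qed
qed

lemma continuous_map_const_paths:
  assumes "continuous_map T K F"
  shows "continuous_map T (compact_open K) (\<lambda>y. \<lambda>s\<in>{0..1}. F y)"
  using continuous_map_curry[OF continuous_map_comp2[OF continuous_map_fst assms]] by simp

text \<open>Keeps the straight-line reparametrisation from \<open>c\<close> to \<open>a\<close>
  inside the unit interval, where the paths are controlled.\<close>

lemma convex_01:
  fixes a c s :: real
  assumes "0 \<le> s" "s \<le> 1" "0 \<le> c" "c \<le> 1" "0 \<le> a" "a \<le> 1"
  shows "0 \<le> (1 - s) * c + s * a" "(1 - s) * c + s * a \<le> 1"
  using assms convex_bound_le[of c 1 a "1 - s" s] by auto

section \<open>Lifts up to fibrewise homotopy\<close>

lemma fw_homotopic_iff:
  "fw_homotopic A K g g' \<longleftrightarrow>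
    (\<exists>H. continuous_map (prod_topology I01 (fst A)) (fst K) H \<and>
      (\<forall>x\<in>topspace (fst A). H (0,x) = g x) \<and> (\<forall>x\<in>topspace (fst A). H (1,x) = g' x) \<and>
      (\<forall>t\<in>{0..1}. \<forall>x\<in>topspace (fst A). snd K (H (t,x)) = snd A x))"
  unfolding fw_homotopic_def by (subst homotopic_with) auto

text \<open>The common shape of the three conditions: a section over an open set, a factorisation of
  the diagonal and a homotopy section of a Ganea map are all lifts of a suitable \<open>g\<close>
  along a suitable \<open>h\<close>.\<close>

definition fw_lifts :: "('a,'b) fws \<Rightarrow> ('y,'b) fws \<Rightarrow> ('k,'b) fws \<Rightarrow> ('y \<Rightarrow> 'k) \<Rightarrow> ('a \<Rightarrow> 'k) \<Rightarrow> bool" where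
  "fw_lifts A Y K h g \<longleftrightarrow> (\<exists>\<phi>. fw_map A Y \<phi> \<and> fw_homotopic A K (h \<circ> \<phi>) g)"

abbreviation fw_restrict :: "('a,'b) fws \<Rightarrow> 'a set \<Rightarrow> ('a,'b) fws" where
  "fw_restrict A U \<equiv> (subtopology (fst A) U, snd A)"

text \<open>The same notion with its witnesses named. Time 0 is \<open>h \<circ> \<phi>\<close> and
  time 1 is \<open>g\<close>; later concatenations rely on this orientation.\<close>

definition fw_lift :: "('a,'b) fws \<Rightarrow> ('y,'b) fws \<Rightarrow> ('k,'b) fws \<Rightarrow> ('y \<Rightarrow> 'k) \<Rightarrow> ('a \<Rightarrow> 'k) \<Rightarrow>
    ('a \<Rightarrow> 'y) \<Rightarrow> (real \<times> 'a \<Rightarrow> 'k) \<Rightarrow> bool" where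
  "fw_lift A Y K h g \<phi> H \<longleftrightarrow> fw_map A Y \<phi> \<and> continuous_map (prod_topology I01 (fst A)) (fst K) H \<and>
    (\<forall>x\<in>topspace (fst A). H (0,x) = h (\<phi> x)) \<and> (\<forall>x\<in>topspace (fst A). H (1,x) = g x) \<and>
    (\<forall>t\<in>{0..1}. \<forall>x\<in>topspace (fst A). snd K (H (t,x)) = snd A x)"

lemma fw_lifts_iff: "fw_lifts A Y K h g \<longleftrightarrow> (\<exists>\<phi> H. fw_lift A Y K h g \<phi> H)"
  unfolding fw_lifts_def fw_lift_def fw_homotopic_iff by auto

lemma fw_liftD:
  assumes "fw_lift A Y K h g \<phi> H"
  shows "continuous_map (fst A) (fst Y) \<phi>"
    and "\<And>x. x \<in> topspace (fst A) \<Longrightarrow> snd Y (\<phi> x) = snd A x"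
    and "continuous_map (prod_topology I01 (fst A)) (fst K) H"
    and "\<And>x. x \<in> topspace (fst A) \<Longrightarrow> H (0,x) = h (\<phi> x)"
    and "\<And>x. x \<in> topspace (fst A) \<Longrightarrow> H (1,x) = g x"
    and "\<And>t x. 0 \<le> t \<Longrightarrow> t \<le> 1 \<Longrightarrow> x \<in> topspace (fst A) \<Longrightarrow> snd K (H (t,x)) = snd A x"
  using assms unfolding fw_lift_def fw_map_def by auto

lemma fw_lifts_restrict_mono:
  assumes "fw_lifts (fw_restrict A U) Y K h g" and "V \<subseteq> U"
  shows "fw_lifts (fw_restrict A V) Y K h g"
proof -
  from assms(1) obtain \<phi> H where L: "fw_lift (fw_restrict A U) Y K h g \<phi> H"
    unfolding fw_lifts_iff by blast
  note H = fw_liftD[OF L, simplified]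
  have "continuous_map (subtopology (fst A) V) (fst Y) \<phi>"
    by (rule continuous_map_from_subtopology_mono[OF H(1) assms(2)])
  moreover have "continuous_map (prod_topology I01 (subtopology (fst A) V)) (fst K) H"
    unfolding prod_topology_subtopology
    by (rule continuous_map_from_subtopology_mono[OF H(3)[unfolded prod_topology_subtopology]])
      (use assms(2) in auto)
  ultimately have "fw_lift (fw_restrict A V) Y K h g \<phi> H"
    using H(2,4-6) assms(2) unfolding fw_lift_def fw_map_def by auto
  then show ?thesis unfolding fw_lifts_iff by blast
qed

text \<open>The three regions are open and overlap in strips, so pasting along open sets applies
  once \<open>f1\<close> agrees with its neighbours on the strips. The middle branch is therefore
  required on a larger region than the one where the formula selects it.\<close>

lemma continuous_map_paste3:
  fixes \<mu> :: "'a \<Rightarrow> real"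
  assumes \<mu>: "continuous_map T euclideanreal \<mu>"
    and "continuous_map (subtopology T {x \<in> topspace T. \<mu> x < 0}) Y f0"
    and "continuous_map (subtopology T {x \<in> topspace T. -1 < \<mu> x \<and> \<mu> x < 2}) Y f1"
    and "continuous_map (subtopology T {x \<in> topspace T. 1 < \<mu> x}) Y f2"
    and eq0: "\<And>x. x \<in> topspace T \<Longrightarrow> -1 < \<mu> x \<Longrightarrow> \<mu> x < 0 \<Longrightarrow> f1 x = f0 x"
    and eq2: "\<And>x. x \<in> topspace T \<Longrightarrow> 1 < \<mu> x \<Longrightarrow> \<mu> x < 2 \<Longrightarrow> f1 x = f2 x"
  shows "continuous_map T Y (\<lambda>x. if \<mu> x < 0 then f0 x else if 1 < \<mu> x then f2 x else f1 x)"
proof -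
  let ?R = "\<lambda>i::nat. if i = 0 then {..<0} else if i = 1 then {-1<..<2} else {1<..} :: real set"
  let ?f = "\<lambda>i::nat. if i = 0 then f0 else if i = 1 then f1 else f2"
  have *: "openin T {x \<in> topspace T. \<mu> x \<in> ?R i}" for i
    by (rule openin_continuous_map_preimage[OF \<mu>]) (auto simp: open_openin[symmetric])
  show ?thesis
  proof (rule pasting_lemma[where I="{0,1,2}" and f="?f" and T="\<lambda>i. {x \<in> topspace T. \<mu> x \<in> ?R i}"])
    show "\<And>i. i \<in> {0,1,2} \<Longrightarrow> openin T {x \<in> topspace T. \<mu> x \<in> ?R i}" using * by blast
    show "\<And>i. i \<in> {0,1,2} \<Longrightarrow> continuous_map (subtopology T {x \<in> topspace T. \<mu> x \<in> ?R i}) Y (?f i)"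
      using assms(2-4) by auto
    show "\<And>i j x. \<lbrakk>i \<in> {0,1,2}; j \<in> {0,1,2}; x \<in> topspace T \<inter> {x \<in> topspace T. \<mu> x \<in> ?R i} \<inter> {x \<in> topspace T. \<mu> x \<in> ?R j}\<rbrakk>
        \<Longrightarrow> ?f i x = ?f j x"
      using eq0 eq2 by (auto split: if_splits)
    fix x assume "x \<in> topspace T"
    then show "\<exists>j. j \<in> {0,1,2} \<and> x \<in> {x \<in> topspace T. \<mu> x \<in> ?R j} \<and>
      (if \<mu> x < 0 then f0 x else if 1 < \<mu> x then f2 x else f1 x) = ?f j x"
      by (intro exI[of _ "if \<mu> x < 0 then 0 else if 1 < \<mu> x then 2 else 1::nat"]) auto
  qed
qed

section \<open>The fibrewise join\<close>

lemma in_topspace_fw_Ehk: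
  "(y,(b,\<theta>),z) \<in> topspace (fw_Ehk B Y Z K h k) \<longleftrightarrow>
    y \<in> topspace (fst Y) \<and> z \<in> topspace (fst Z) \<and> b \<in> topspace B \<and> \<theta> \<in> extensional {0..1} \<and>
    continuous_map I01 (fst K) \<theta> \<and> (\<forall>s\<in>{0..1}. snd K (\<theta> s) = b) \<and> h y = \<theta> 0 \<and> k z = \<theta> 1"
  unfolding fw_Ehk_def fw_paths_def by auto

lemma continuous_map_fw_Ehk:
  "continuous_map (fw_Ehk B Y Z K h k) (fst Y) (\<lambda>w. fst w)"
  "continuous_map (fw_Ehk B Y Z K h k) B (\<lambda>w. fst (fst (snd w)))"
  "continuous_map (fw_Ehk B Y Z K h k) (compact_open (fst K)) (\<lambda>w. snd (fst (snd w)))"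
  "continuous_map (fw_Ehk B Y Z K h k) (fst Z) (\<lambda>w. snd (snd w))"
proof -
  let ?P = "prod_topology (fst Y) (prod_topology (fw_paths B K) (fst Z))"
  have paths: "continuous_map (fw_paths B K) B fst"
    "continuous_map (fw_paths B K) (compact_open (fst K)) snd"
    unfolding fw_paths_def
    by (auto intro: continuous_map_from_subtopology continuous_map_fst continuous_map_snd)
  have c1: "continuous_map ?P (fst Y) fst"
    and c2: "continuous_map ?P (prod_topology (fw_paths B K) (fst Z)) snd"
    by (auto intro: continuous_map_fst continuous_map_snd)
  have c3: "continuous_map ?P (fw_paths B K) (\<lambda>w. fst (snd w))"
    and c4: "continuous_map ?P (fst Z) (\<lambda>w. snd (snd w))"
    by (auto intro: continuous_map_comp2[OF c2] continuous_map_fst continuous_map_snd)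
  show "continuous_map (fw_Ehk B Y Z K h k) (fst Y) (\<lambda>w. fst w)"
    "continuous_map (fw_Ehk B Y Z K h k) B (\<lambda>w. fst (fst (snd w)))"
    "continuous_map (fw_Ehk B Y Z K h k) (compact_open (fst K)) (\<lambda>w. snd (fst (snd w)))"
    "continuous_map (fw_Ehk B Y Z K h k) (fst Z) (\<lambda>w. snd (snd w))"
    unfolding fw_Ehk_def
    by (intro continuous_map_from_subtopology c1 c4 continuous_map_comp2[OF c3 paths(1)]
        continuous_map_comp2[OF c3 paths(2)])+
qed

lemma continuous_map_into_fw_Ehk:
  assumes "continuous_map A (fst Y) s" "continuous_map A B p" "continuous_map A (compact_open (fst K)) P"
    "continuous_map A (fst Z) t"
    and "\<And>a. a \<in> topspace A \<Longrightarrow> P a \<in> extensional {0..1} \<and> continuous_map I01 (fst K) (P a) \<and>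
      (\<forall>\<tau>\<in>{0..1}. snd K (P a \<tau>) = p a) \<and> h (s a) = P a 0 \<and> k (t a) = P a 1"
  shows "continuous_map A (fw_Ehk B Y Z K h k) (\<lambda>a. (s a, (p a, P a), t a))"
  unfolding fw_Ehk_def fw_paths_def
  by (intro continuous_map_into_subtopology continuous_map_pairedI assms) (use assms(5) in auto)

text \<open>Points of the quotient are encoded by representatives. Injective and disjoint
  constructors give each point exactly one form, on which the definite descriptions of the
  projection and of the join map depend.\<close>

locale fw_joinable =
  fixes B :: "'b topology" and Y :: "('y,'b) fws" and Z :: "('z,'b) fws" and K :: "('k,'b) fws"
    and h :: "'y \<Rightarrow> 'k" and k :: "'z \<Rightarrow> 'k"
    and inl :: "'y \<Rightarrow> 'u" and inr :: "'z \<Rightarrow> 'u"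
    and mid :: "'y \<Rightarrow> 'b \<Rightarrow> (real \<Rightarrow> 'k) \<Rightarrow> 'z \<Rightarrow> real \<Rightarrow> 'u"
  assumes Y: "fw_space B Y" and Z: "fw_space B Z" and h: "fw_map Y K h" and k: "fw_map Z K k"
    and inj: "inl y = inl y' \<longleftrightarrow> y = y'" "inr z = inr z' \<longleftrightarrow> z = z'"
      "mid y b \<theta> z t = mid y' b' \<theta>' z' t' \<longleftrightarrow> y = y' \<and> b = b' \<and> \<theta> = \<theta>' \<and> z = z' \<and> t = t'"
    and disj: "inl y \<noteq> inr z" "inr z \<noteq> inl y" "inl y' \<noteq> mid y b \<theta> z t" "mid y b \<theta> z t \<noteq> inl y'"
      "inr z' \<noteq> mid y b \<theta> z t" "mid y b \<theta> z t \<noteq> inr z'"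
begin

abbreviation "EE \<equiv> fw_Ehk B Y Z K h k"
abbreviation "q \<equiv> fw_join_q inl inr mid"
definition "J = fst (fw_join B Y Z K h k inl inr mid)"
definition "pJ = fst (snd (fw_join B Y Z K h k inl inr mid))"
definition "jJ = snd (snd (fw_join B Y Z K h k inl inr mid))"

definition "join_points = inl ` topspace (fst Y) \<union> inr ` topspace (fst Z) \<union>
   (\<lambda>(w,t). q w t) ` (topspace EE \<times> {0..1})"

lemma q_simps:
  "q (y,(b,\<theta>),z) 0 = inl y" "q (y,(b,\<theta>),z) 1 = inr z"
  "0 < t \<Longrightarrow> t < 1 \<Longrightarrow> q (y,(b,\<theta>),z) t = mid y b \<theta> z t"
  by (auto simp: fw_join_q_def)

text \<open>Preimages commute with intersections and unions, so the defining condition is a topology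
  and the abstract type recovers it unchanged.\<close>

lemma openin_J:
  "openin J U \<longleftrightarrow> U \<subseteq> join_points \<and> openin (fst Y) {y \<in> topspace (fst Y). inl y \<in> U} \<and>
    openin (fst Z) {z \<in> topspace (fst Z). inr z \<in> U} \<and>
    openin (prod_topology EE I01) {p \<in> topspace (prod_topology EE I01). q (fst p) (snd p) \<in> U}"
  (is "_ \<longleftrightarrow> ?O U")
proof -
  have Int: "openin T {x \<in> topspace T. F x \<in> U \<inter> V}"
    if "openin T {x \<in> topspace T. F x \<in> U}" "openin T {x \<in> topspace T. F x \<in> V}"
    for T :: "'a topology" and F :: "'a \<Rightarrow> 'u" and U V
    using openin_Int[OF that] by (rule back_subst) auto
  have Un: "openin T {x \<in> topspace T. F x \<in> \<Union>\<U>}"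
    if "\<And>U. U \<in> \<U> \<Longrightarrow> openin T {x \<in> topspace T. F x \<in> U}"
    for T :: "'a topology" and F :: "'a \<Rightarrow> 'u" and \<U>
    using openin_Union[of "(\<lambda>U. {x \<in> topspace T. F x \<in> U}) ` \<U>" T] that
    by (elim meta_impE, blast) (erule back_subst, blast)
  have "istopology ?O"
    unfolding istopology_def
    by (intro conjI allI impI Int Un) blast+
  then show ?thesis
    unfolding J_def fw_join_def Let_def fst_conv join_points_def by simp
qed

lemma topspace_J: "topspace J = join_points"
proof (rule antisym)
  show "topspace J \<subseteq> join_points" using openin_J[of "topspace J"] by simp
  have 1: "{y \<in> topspace (fst Y). inl y \<in> join_points} = topspace (fst Y)"
    "{z \<in> topspace (fst Z). inr z \<in> join_points} = topspace (fst Z)"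
    unfolding join_points_def by blast+
  have 2: "{p \<in> topspace (prod_topology EE I01). q (fst p) (snd p) \<in> join_points}
     = topspace (prod_topology EE I01)"
    unfolding join_points_def by force
  have "openin J join_points" unfolding openin_J 1 2 by (intro conjI openin_topspace subset_refl)
  then show "join_points \<subseteq> topspace J" by (rule openin_subset)
qed

lemma join_cases [consumes 1, case_names inl inr mid]:
  assumes "u \<in> topspace J"
  obtains y where "y \<in> topspace (fst Y)" "u = inl y"
  | z where "z \<in> topspace (fst Z)" "u = inr z"
  | y b \<theta> z t where "(y,(b,\<theta>),z) \<in> topspace EE" "0 < t" "t < 1" "u = mid y b \<theta> z t"
proof -
  note cases = that
  have *: thesis if w: "w \<in> topspace EE" and t: "t \<in> {0..1}" and u: "u = q w t" for w t
  proof -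
    obtain y b \<theta> z where w': "w = (y,(b,\<theta>),z)" by (metis prod.exhaust)
    then have yz: "y \<in> topspace (fst Y)" "z \<in> topspace (fst Z)"
      using w by (auto simp: in_topspace_fw_Ehk)
    consider "t = 0" | "t = 1" | "0 < t" "t < 1" using t by force
    then show thesis
      by cases (use cases(1)[OF yz(1)] cases(2)[OF yz(2)] cases(3) w u w' in \<open>auto simp: q_simps\<close>)
  qed
  show thesis using assms unfolding topspace_J join_points_def using * cases(1,2) by auto
qed

lemma inl_in: "y \<in> topspace (fst Y) \<Longrightarrow> inl y \<in> topspace J"
  and inr_in: "z \<in> topspace (fst Z) \<Longrightarrow> inr z \<in> topspace J"
  and q_in: "w \<in> topspace EE \<Longrightarrow> 0 \<le> t \<Longrightarrow> t \<le> 1 \<Longrightarrow> q w t \<in> topspace J"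
  unfolding topspace_J join_points_def by force+

lemma continuous_map_inl: "continuous_map (fst Y) J inl"
  unfolding continuous_map using inl_in openin_J by auto

lemma continuous_map_inr: "continuous_map (fst Z) J inr"
  unfolding continuous_map using inr_in openin_J by auto

lemma continuous_map_q: "continuous_map (prod_topology EE I01) J (\<lambda>p. q (fst p) (snd p))"
  unfolding continuous_map using q_in openin_J by auto

text \<open>A quotient map stays a quotient map over an open subset of its target, so continuity on
  an open part of the join can be tested on the three pieces. This serves for maps defined only away
  from one end.\<close>

lemma continuous_map_from_open_J:
  assumes D: "openin J D"
    and "continuous_map (subtopology (fst Y) {y \<in> topspace (fst Y). inl y \<in> D}) T (\<lambda>y. F (inl y))"
    and "continuous_map (subtopology (fst Z) {z \<in> topspace (fst Z). inr z \<in> D}) T (\<lambda>z. F (inr z))"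
    and "continuous_map (subtopology (prod_topology EE I01)
           {p \<in> topspace (prod_topology EE I01). q (fst p) (snd p) \<in> D}) T (\<lambda>p. F (q (fst p) (snd p)))"
  shows "continuous_map (subtopology J D) T F"
  unfolding continuous_map
proof (intro conjI allI impI)
  have DJ: "D \<subseteq> topspace J" using D by (rule openin_subset)
  have D': "openin (fst Y) {y \<in> topspace (fst Y). inl y \<in> D}"
    "openin (fst Z) {z \<in> topspace (fst Z). inr z \<in> D}"
    "openin (prod_topology EE I01) {p \<in> topspace (prod_topology EE I01). q (fst p) (snd p) \<in> D}"
    using D openin_J by auto
  have img: "F (inl y) \<in> topspace T" if "y \<in> topspace (fst Y)" "inl y \<in> D" for y
    using continuous_map_image_subset_topspace[OF assms(2)] that by auto
  have img2: "F (inr z) \<in> topspace T" if "z \<in> topspace (fst Z)" "inr z \<in> D" for z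
    using continuous_map_image_subset_topspace[OF assms(3)] that by auto
  have img3: "F (mid y b \<theta> z t) \<in> topspace T"
    if "(y,(b,\<theta>),z) \<in> topspace EE" "0 < t" "t < 1" "mid y b \<theta> z t \<in> D" for y b \<theta> z t
  proof -
    have "((y,(b,\<theta>),z),t) \<in> {p \<in> topspace (prod_topology EE I01). q (fst p) (snd p) \<in> D}"
      using that by (simp add: q_simps)
    then have "F (q (fst ((y,(b,\<theta>),z),t)) (snd ((y,(b,\<theta>),z),t))) \<in> topspace T"
      using continuous_map_image_subset_topspace[OF assms(4)] by fastforce
    then show ?thesis using that by (simp add: q_simps)
  qed
  have "F u \<in> topspace T" if "u \<in> D" for u
  proof -
    have "u \<in> topspace J" using DJ that by blast
    then show ?thesis by (cases rule: join_cases) (use img img2 img3 that in auto)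
  qed
  then show "F ` topspace (subtopology J D) \<subseteq> topspace T" by auto
  fix U assume U: "openin T U"
  have "openin (fst Y) {y \<in> topspace (fst Y). inl y \<in> {u \<in> D. F u \<in> U}}"
    using openin_trans_full[OF openin_continuous_map_preimage[OF assms(2) U] D'(1)]
    by (rule back_subst) auto
  moreover have "openin (fst Z) {z \<in> topspace (fst Z). inr z \<in> {u \<in> D. F u \<in> U}}"
    using openin_trans_full[OF openin_continuous_map_preimage[OF assms(3) U] D'(2)]
    by (rule back_subst) auto
  moreover have "openin (prod_topology EE I01)
      {p \<in> topspace (prod_topology EE I01). q (fst p) (snd p) \<in> {u \<in> D. F u \<in> U}}"
    using openin_trans_full[OF openin_continuous_map_preimage[OF assms(4) U] D'(3)]
    by (rule back_subst) auto
  ultimately have "openin J {u \<in> D. F u \<in> U}"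
    unfolding openin_J using DJ topspace_J by auto
  moreover have "{u \<in> topspace (subtopology J D). F u \<in> U} = {u \<in> D. F u \<in> U}"
    using DJ by auto
  ultimately show "openin (subtopology J D) {u \<in> topspace (subtopology J D). F u \<in> U}"
    using D openin_open_subtopology by auto
qed

lemma continuous_map_from_J:
  assumes "continuous_map (fst Y) T (\<lambda>y. F (inl y))" "continuous_map (fst Z) T (\<lambda>z. F (inr z))"
    and "continuous_map (prod_topology EE I01) T (\<lambda>p. F (q (fst p) (snd p)))"
  shows "continuous_map J T F"
  using continuous_map_from_open_J[of "topspace J" T F] assms
  by (simp add: continuous_map_from_subtopology)

lemma pJ_inl: "y \<in> topspace (fst Y) \<Longrightarrow> pJ (inl y) = snd Y y"
  and pJ_inr: "z \<in> topspace (fst Z) \<Longrightarrow> pJ (inr z) = snd Z z"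
  and pJ_mid: "(y,(b,\<theta>),z) \<in> topspace EE \<Longrightarrow> 0 < t \<Longrightarrow> t < 1 \<Longrightarrow> pJ (mid y b \<theta> z t) = b"
  unfolding pJ_def fw_join_def Let_def fst_conv snd_conv
  by (rule the_equality; auto simp: inj disj)+

lemma jJ_inl: "y \<in> topspace (fst Y) \<Longrightarrow> jJ (inl y) = h y"
  and jJ_inr: "z \<in> topspace (fst Z) \<Longrightarrow> jJ (inr z) = k z"
  and jJ_mid: "(y,(b,\<theta>),z) \<in> topspace EE \<Longrightarrow> 0 < t \<Longrightarrow> t < 1 \<Longrightarrow> jJ (mid y b \<theta> z t) = \<theta> t"
  unfolding jJ_def fw_join_def Let_def fst_conv snd_conv
  by (rule the_equality; auto simp: inj disj)+

lemma EE_fibre: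
  assumes "(y,(b,\<theta>),z) \<in> topspace EE" shows "snd Y y = b" "snd Z z = b"
  using assms h k unfolding in_topspace_fw_Ehk fw_map_def by force+

text \<open>One formula also covers the two faces of the cylinder, because the endpoints of a path
  lie over the same base point as the path.\<close>

lemma pJ_q:
  assumes "w \<in> topspace EE" "0 \<le> t" "t \<le> 1"
  shows "pJ (q w t) = fst (fst (snd w))"
proof -
  obtain y b \<theta> z where w: "w = (y,(b,\<theta>),z)" by (metis prod.exhaust)
  then have EE: "(y,(b,\<theta>),z) \<in> topspace EE" using assms by simp
  then have yz: "y \<in> topspace (fst Y)" "z \<in> topspace (fst Z)" by (simp_all add: in_topspace_fw_Ehk)
  consider "t = 0" | "t = 1" | "0 < t" "t < 1" using assms by force
  then show ?thesis
    by cases (use EE_fibre[OF EE] EE yz w in \<open>auto simp: q_simps pJ_inl pJ_inr pJ_mid\<close>)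
qed

text \<open>On the faces the values \<open>h y\<close> and \<open>k z\<close> are the endpoints of
  the path, so evaluation at \<open>t\<close> describes the join map on the whole cylinder.\<close>

lemma jJ_q:
  assumes "w \<in> topspace EE" "0 \<le> t" "t \<le> 1"
  shows "jJ (q w t) = snd (fst (snd w)) t"
proof -
  obtain y b \<theta> z where w: "w = (y,(b,\<theta>),z)" by (metis prod.exhaust)
  consider "t = 0" | "t = 1" | "0 < t" "t < 1" using assms by force
  then show ?thesis
    by cases (use assms w in \<open>auto simp: in_topspace_fw_Ehk q_simps jJ_inl jJ_inr jJ_mid\<close>)
qed

lemma EE_path_continuous: "w \<in> topspace EE \<Longrightarrow> continuous_map I01 (fst K) (snd (fst (snd w)))"
  by (cases w) (auto simp: in_topspace_fw_Ehk)

lemma continuous_map_path_eval: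
  assumes w: "continuous_map A EE w" and t: "continuous_map A I01 t"
  shows "continuous_map A (fst K) (\<lambda>a. snd (fst (snd (w a))) (t a))"
  by (rule continuous_map_eval[OF continuous_map_comp2[OF w continuous_map_fw_Ehk(3)] t])
    (use continuous_map_image_subset_topspace[OF w] EE_path_continuous in blast)

lemma fw_space_join: "fw_space B (J, pJ)"
  unfolding fw_space_def fst_conv snd_conv
proof (rule continuous_map_from_J)
  show "continuous_map (fst Y) B (\<lambda>y. pJ (inl y))"
    by (rule continuous_map_eq[OF Y[unfolded fw_space_def]]) (simp add: pJ_inl)
  show "continuous_map (fst Z) B (\<lambda>z. pJ (inr z))"
    by (rule continuous_map_eq[OF Z[unfolded fw_space_def]]) (simp add: pJ_inr)
  show "continuous_map (prod_topology EE I01) B (\<lambda>p. pJ (q (fst p) (snd p)))"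
    by (rule continuous_map_eq[OF continuous_map_comp2[OF continuous_map_fst continuous_map_fw_Ehk(2)]])
      (auto simp: pJ_q)
qed

lemma fw_map_join: "fw_map (J, pJ) K jJ"
  unfolding fw_map_def fst_conv snd_conv
proof (intro conjI ballI)
  show "continuous_map J (fst K) jJ"
  proof (rule continuous_map_from_J)
    show "continuous_map (fst Y) (fst K) (\<lambda>y. jJ (inl y))"
      by (rule continuous_map_eq[where f=h]) (use h in \<open>auto simp: jJ_inl fw_map_def\<close>)
    show "continuous_map (fst Z) (fst K) (\<lambda>z. jJ (inr z))"
      by (rule continuous_map_eq[where f=k]) (use k in \<open>auto simp: jJ_inr fw_map_def\<close>)
    show "continuous_map (prod_topology EE I01) (fst K) (\<lambda>p. jJ (q (fst p) (snd p)))"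
      by (rule continuous_map_eq[OF continuous_map_path_eval[OF continuous_map_fst continuous_map_snd]])
        (auto simp: jJ_q)
  qed
  fix u assume "u \<in> topspace J"
  then show "snd K (jJ u) = pJ u"
    by (cases rule: join_cases)
      (use h k in \<open>auto simp: fw_map_def pJ_inl pJ_inr pJ_mid jJ_inl jJ_inr jJ_mid in_topspace_fw_Ehk\<close>)
qed

end

text \<open>The lifting homotopy precomposed with \<open>\<phi>\<close> ends at
  \<open>j \<circ> \<phi>\<close>, and the given homotopy continues it to \<open>g\<close>.\<close>

lemma fw_lifts_precompose:
  assumes L: "fw_lifts C Y K h j" and \<phi>: "fw_map A C \<phi>" and g: "fw_homotopic A K (j \<circ> \<phi>) g"
  shows "fw_lifts A Y K h g"
proof -
  from L obtain \<psi> H where "fw_lift C Y K h j \<psi> H" unfolding fw_lifts_iff by blast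
  note H = fw_liftD[OF this]
  have \<phi>c: "continuous_map (fst A) (fst C) \<phi>" and \<phi>p: "\<And>x. x \<in> topspace (fst A) \<Longrightarrow> snd C (\<phi> x) = snd A x"
    using \<phi> by (auto simp: fw_map_def)
  have \<phi>in: "\<phi> x \<in> topspace (fst C)" if "x \<in> topspace (fst A)" for x
    using continuous_map_image_subset_topspace[OF \<phi>c] that by blast
  have "continuous_map (prod_topology I01 (fst A)) (prod_topology I01 (fst C)) (\<lambda>p. (fst p, \<phi> (snd p)))"
    by (intro continuous_map_pairedI continuous_map_fst continuous_map_comp2[OF continuous_map_snd \<phi>c])
  from continuous_map_comp2[OF this H(3)]
  have "continuous_map (prod_topology I01 (fst A)) (fst K) (\<lambda>p. H (fst p, \<phi> (snd p)))" .
  then have "fw_homotopic A K (h \<circ> (\<psi> \<circ> \<phi>)) (j \<circ> \<phi>)"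
    unfolding fw_homotopic_iff
    by (intro exI[of _ "\<lambda>p. H (fst p, \<phi> (snd p))"]) (use H(4-6) \<phi>in \<phi>p in auto)
  then have "fw_homotopic A K (h \<circ> (\<psi> \<circ> \<phi>)) g"
    using g unfolding fw_homotopic_def by (rule homotopic_with_trans)
  moreover have "fw_map A Y (\<psi> \<circ> \<phi>)"
    using continuous_map_compose[OF \<phi>c H(1)] H(2) \<phi>in \<phi>p by (simp add: fw_map_def)
  ultimately show ?thesis unfolding fw_lifts_def by blast
qed

lemma fw_homotopic_restrict:
  assumes "fw_homotopic A K g g'" shows "fw_homotopic (fw_restrict A U) K g g'"
proof -
  from assms obtain H where H: "continuous_map (prod_topology I01 (fst A)) (fst K) H"
      "\<forall>x\<in>topspace (fst A). H (0,x) = g x" "\<forall>x\<in>topspace (fst A). H (1,x) = g' x"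
      "\<forall>t\<in>{0..1}. \<forall>x\<in>topspace (fst A). snd K (H (t,x)) = snd A x"
    unfolding fw_homotopic_iff by blast
  then show ?thesis unfolding fw_homotopic_iff
    by (intro exI[of _ H]) (auto simp: prod_topology_subtopology continuous_map_from_subtopology)
qed

section \<open>Deforming the join minus one end, and splitting lifts\<close>

context fw_joinable
begin

text \<open>Moves a point \<open>mid y b \<theta> z t\<close> along its path \<open>\<theta>\<close>, starting at parameter \<open>c\<close> and ending at \<open>t\<close>;
  it deforms the join minus one end onto the other end, for \<open>c = 0\<close> and \<open>c = 1\<close> respectively.\<close>
definition slide :: "real \<Rightarrow> 'u \<Rightarrow> real \<Rightarrow> 'k" where
  "slide c u = (\<lambda>s\<in>{0..1}. if \<exists>y b \<theta> z t. u = mid y b \<theta> z t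
     then (THE v. \<exists>y b \<theta> z t. u = mid y b \<theta> z t \<and> v = \<theta> ((1 - s) * c + s * t)) else jJ u)"

lemma slide_inl: "slide c (inl y) = (\<lambda>s\<in>{0..1}. jJ (inl y))"
  and slide_inr: "slide c (inr z) = (\<lambda>s\<in>{0..1}. jJ (inr z))"
  and slide_mid: "slide c (mid y b \<theta> z t) = (\<lambda>s\<in>{0..1}. \<theta> ((1 - s) * c + s * t))"
  unfolding slide_def by (rule restrict_ext; simp add: inj disj)+

text \<open>At the end with \<open>t = c\<close> the moving parameter stays at \<open>c\<close>, so
  the formula yields the constant path used there. At the opposite end it would run along the whole
  path instead, which is why that end is excluded.\<close>

lemma slide_q:
  assumes w: "w \<in> topspace EE" and t: "0 \<le> t" "t \<le> 1" and c: "c = 0 \<and> t < 1 \<or> c = 1 \<and> 0 < t"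
  shows "slide c (q w t) = (\<lambda>s\<in>{0..1}. snd (fst (snd w)) ((1 - s) * c + s * t))"
proof -
  obtain y b \<theta> z where w': "w = (y,(b,\<theta>),z)" by (metis prod.exhaust)
  consider "t = 0" "c = 0" | "t = 1" "c = 1" | "0 < t" "t < 1" using t c by force
  then show ?thesis
    by cases (use w w' in \<open>auto simp: in_topspace_fw_Ehk q_simps slide_inl slide_inr slide_mid jJ_inl jJ_inr
        intro!: restrict_ext\<close>)
qed

lemma continuous_map_slide_q:
  assumes P: "P \<subseteq> topspace (prod_topology EE I01)"
    and c: "\<And>p. p \<in> P \<Longrightarrow> c = 0 \<and> snd p < 1 \<or> c = 1 \<and> 0 < snd p"
  shows "continuous_map (subtopology (prod_topology EE I01) P) (compact_open (fst K)) (\<lambda>p. slide c (q (fst p) (snd p)))"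
proof -
  let ?T = "subtopology (prod_topology EE I01) P"
  have EEc: "continuous_map (prod_topology ?T I01) EE (\<lambda>a. fst (fst a))"
    by (intro continuous_map_comp2[OF continuous_map_fst] continuous_map_from_subtopology continuous_map_fst)
  have r1: "continuous_map (prod_topology ?T I01) euclideanreal (\<lambda>a. snd (fst a))"
    by (intro continuous_map_comp2[OF continuous_map_fst] continuous_map_from_subtopology continuous_map_fst_snd_I01)
  have "continuous_map (prod_topology ?T I01) I01 (\<lambda>a. (1 - snd a) * c + snd a * snd (fst a))"
    unfolding continuous_map_I01
  proof (intro conjI ballI)
    show "continuous_map (prod_topology ?T I01) euclideanreal (\<lambda>a. (1 - snd a) * c + snd a * snd (fst a))"
      by (intro continuous_intros continuous_map_fst_snd_I01 r1)
    fix a assume a: "a \<in> topspace (prod_topology ?T I01)"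
    then have "fst a \<in> P" by auto
    then have "0 \<le> c" "c \<le> 1" "0 \<le> snd (fst a)" "snd (fst a) \<le> 1" using c[of "fst a"] P by auto
    then show "0 \<le> (1 - snd a) * c + snd a * snd (fst a)" "(1 - snd a) * c + snd a * snd (fst a) \<le> 1"
      using convex_01[of "snd a" c "snd (fst a)"] a by auto
  qed
  from continuous_map_curry[OF continuous_map_path_eval[OF EEc this]]
  show ?thesis
  proof (rule continuous_map_eq)
    fix p assume "p \<in> topspace ?T"
    then have "p \<in> P" "fst p \<in> topspace EE" "0 \<le> snd p" "snd p \<le> 1" by auto
    then show "(\<lambda>s\<in>{0..1}. snd (fst (snd (fst (fst (p, s))))) ((1 - snd (p, s)) * c + snd (p, s) * snd (fst (p, s))))
      = slide c (q (fst p) (snd p))" using c[of p] by (simp add: slide_q)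
  qed
qed

text \<open>Each part is named after the end that it retains: without the \<open>Z\<close> end every
  point has a \<open>Y\<close> component, and vice versa.\<close>

definition "left_part = topspace J - inr ` topspace (fst Z)"
definition "right_part = topspace J - inl ` topspace (fst Y)"

text \<open>On the cylinder the removed end is exactly the face at 1, so the part is cut out by the
  open condition \<open>t < 1\<close>.\<close>

lemma preimage_left_part:
  "{y \<in> topspace (fst Y). inl y \<in> left_part} = topspace (fst Y)"
  "{z \<in> topspace (fst Z). inr z \<in> left_part} = {}"
  "{p \<in> topspace (prod_topology EE I01). q (fst p) (snd p) \<in> left_part}
    = {p \<in> topspace (prod_topology EE I01). snd p \<in> {..<1}}"
proof -
  have "q w t \<in> left_part \<longleftrightarrow> t < 1" if "w \<in> topspace EE" "0 \<le> t" "t \<le> 1" for w t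
    using that q_in[OF that]
    by (cases w) (auto simp: fw_join_q_def left_part_def disj inj in_topspace_fw_Ehk split: if_splits)
  then show "{p \<in> topspace (prod_topology EE I01). q (fst p) (snd p) \<in> left_part}
    = {p \<in> topspace (prod_topology EE I01). snd p \<in> {..<1}}" by auto
qed (auto simp: left_part_def inl_in inj disj)

lemma preimage_right_part:
  "{y \<in> topspace (fst Y). inl y \<in> right_part} = {}"
  "{z \<in> topspace (fst Z). inr z \<in> right_part} = topspace (fst Z)"
  "{p \<in> topspace (prod_topology EE I01). q (fst p) (snd p) \<in> right_part}
    = {p \<in> topspace (prod_topology EE I01). snd p \<in> {0<..}}"
proof -
  have "q w t \<in> right_part \<longleftrightarrow> 0 < t" if "w \<in> topspace EE" "0 \<le> t" "t \<le> 1" for w t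
    using that q_in[OF that]
    by (cases w) (auto simp: fw_join_q_def right_part_def disj inj in_topspace_fw_Ehk split: if_splits)
  then show "{p \<in> topspace (prod_topology EE I01). q (fst p) (snd p) \<in> right_part}
    = {p \<in> topspace (prod_topology EE I01). snd p \<in> {0<..}}" by auto
qed (auto simp: right_part_def inr_in inj disj)

lemma openin_left_part: "openin J left_part"
  unfolding openin_J preimage_left_part
  by (intro conjI openin_topspace openin_empty openin_continuous_map_preimage[OF continuous_map_fst_snd_I01(1)])
    (auto simp: left_part_def topspace_J open_openin[symmetric])

lemma openin_right_part: "openin J right_part"
  unfolding openin_J preimage_right_part
  by (intro conjI openin_topspace openin_empty openin_continuous_map_preimage[OF continuous_map_fst_snd_I01(1)])
    (auto simp: right_part_def topspace_J open_openin[symmetric])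

lemma continuous_map_jJ_ends:
  "continuous_map (fst Y) (fst K) (\<lambda>y. jJ (inl y))" "continuous_map (fst Z) (fst K) (\<lambda>z. jJ (inr z))"
  using fw_map_join continuous_map_comp2[OF continuous_map_inl] continuous_map_comp2[OF continuous_map_inr]
  by (auto simp: fw_map_def)

lemma continuous_map_slide_left: "continuous_map (subtopology J left_part) (compact_open (fst K)) (slide 0)"
proof (rule continuous_map_from_open_J[OF openin_left_part], unfold preimage_left_part)
  show "continuous_map (subtopology (fst Y) (topspace (fst Y))) (compact_open (fst K)) (\<lambda>y. slide 0 (inl y))"
    using continuous_map_const_paths[OF continuous_map_jJ_ends(1)] by (simp add: slide_inl)
  show "continuous_map (subtopology (prod_topology EE I01) {p \<in> topspace (prod_topology EE I01). snd p \<in> {..<1}})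
      (compact_open (fst K)) (\<lambda>p. slide 0 (q (fst p) (snd p)))"
    by (rule continuous_map_slide_q) auto
qed simp

lemma continuous_map_slide_right: "continuous_map (subtopology J right_part) (compact_open (fst K)) (slide 1)"
proof (rule continuous_map_from_open_J[OF openin_right_part], unfold preimage_right_part)
  show "continuous_map (subtopology (fst Z) (topspace (fst Z))) (compact_open (fst K)) (\<lambda>z. slide 1 (inr z))"
    using continuous_map_const_paths[OF continuous_map_jJ_ends(2)] by (simp add: slide_inr)
  show "continuous_map (subtopology (prod_topology EE I01) {p \<in> topspace (prod_topology EE I01). snd p \<in> {0<..}})
      (compact_open (fst K)) (\<lambda>p. slide 1 (q (fst p) (snd p)))"
    by (rule continuous_map_slide_q) auto
qed simp

lemma slide_path:
  assumes u: "u \<in> topspace J" and c: "0 \<le> c" "c \<le> 1"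
  shows "continuous_map I01 (fst K) (slide c u)"
    and "0 \<le> s \<Longrightarrow> s \<le> 1 \<Longrightarrow> snd K (slide c u s) = pJ u"
    and "slide c u 1 = jJ u"
proof -
  have jJ: "jJ u \<in> topspace (fst K)" "snd K (jJ u) = pJ u"
    using u fw_map_join continuous_map_image_subset_topspace by (fastforce simp: fw_map_def)+
  have const: "continuous_map I01 (fst K) (\<lambda>s\<in>{0..1}. jJ u)"
    by (rule continuous_map_eq[where f="\<lambda>_. jJ u"]) (use jJ in auto)
  have "continuous_map I01 (fst K) (slide c u) \<and> (\<forall>s\<in>{0..1}. snd K (slide c u s) = pJ u) \<and> slide c u 1 = jJ u"
    using u
  proof (cases rule: join_cases)
    case (inl y) then show ?thesis using const jJ by (simp add: slide_inl)
  next
    case (inr z) then show ?thesis using const jJ by (simp add: slide_inr)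
  next
    case (mid y b \<theta> z t)
    have id: "continuous_map I01 euclideanreal (\<lambda>s. s)"
      using continuous_map_from_subtopology[OF continuous_map_id[of euclideanreal]] by (simp add: id_def)
    have "continuous_map I01 I01 (\<lambda>s. (1 - s) * c + s * t)"
      unfolding continuous_map_I01
      by (intro conjI ballI continuous_intros id) (use convex_01[of _ c t] mid c in auto)
    moreover have "continuous_map I01 (fst K) \<theta>" using mid by (simp add: in_topspace_fw_Ehk)
    ultimately have "continuous_map I01 (fst K) (\<lambda>s. \<theta> ((1 - s) * c + s * t))"
      by (rule continuous_map_comp2)
    then have "continuous_map I01 (fst K) (\<lambda>s\<in>{0..1}. \<theta> ((1 - s) * c + s * t))"
      by (rule continuous_map_eq) simp
    moreover have "snd K (\<theta> ((1 - s) * c + s * t)) = b" if "s \<in> {0..1}" for s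
      using mid convex_01[of s c t] c that by (auto simp: in_topspace_fw_Ehk)
    ultimately show ?thesis using mid by (auto simp: slide_mid pJ_mid jJ_mid)
  qed
  then show "continuous_map I01 (fst K) (slide c u)"
    and "0 \<le> s \<Longrightarrow> s \<le> 1 \<Longrightarrow> snd K (slide c u s) = pJ u" and "slide c u 1 = jJ u" by auto
qed

text \<open>Uncurrying \<open>slide c\<close> gives a homotopy from its initial values, which are
  \<open>v (r u)\<close>, to the join map. Both ends use this form.\<close>

lemma fw_lifts_part:
  assumes D: "D \<subseteq> topspace J" and c: "0 \<le> c" "c \<le> 1"
    and sl: "continuous_map (subtopology J D) (compact_open (fst K)) (slide c)"
    and r: "continuous_map (subtopology J D) (fst V) r"
    and rv: "\<And>u. u \<in> D \<Longrightarrow> snd V (r u) = pJ u \<and> v (r u) = slide c u 0"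
  shows "fw_lifts (fw_restrict (J, pJ) D) V K v jJ"
proof -
  have "continuous_map (prod_topology I01 (subtopology J D)) (fst K) (\<lambda>p. slide c (snd p) (fst p))"
    by (rule continuous_map_eval[OF continuous_map_comp2[OF continuous_map_snd sl] continuous_map_fst])
      (use D c slide_path in auto)
  then have "fw_lift (fw_restrict (J, pJ) D) V K v jJ r (\<lambda>p. slide c (snd p) (fst p))"
    unfolding fw_lift_def fw_map_def using D c r rv slide_path by auto
  then show ?thesis unfolding fw_lifts_iff by blast
qed

text \<open>Points are sent to their \<open>Y\<close> component; sliding from parameter 0, where the
  path is at \<open>h y\<close>, connects \<open>h y\<close> with the value of the join map.\<close>

lemma fw_lifts_left_part: "fw_lifts (fw_restrict (J, pJ) left_part) Y K h jJ"
proof -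
  \<comment> \<open>The value at \<open>inr\<close> points is meaningless, and such points are
    absent from \<open>left_part\<close>.\<close>
  define r where "r u = (THE y. u = inl y \<or> (\<exists>b \<theta> z t. u = mid y b \<theta> z t))" for u
  have r: "r (inl y) = y" "r (mid y b \<theta> z t) = y" for y b \<theta> z t
    unfolding r_def by (auto simp: inj disj)
  have rq: "r (q w t) = fst w" if "t < 1" for w t
    using that by (cases w) (auto simp: fw_join_q_def r)
  have "continuous_map (subtopology J left_part) (fst Y) r"
  proof (rule continuous_map_from_open_J[OF openin_left_part], unfold preimage_left_part)
    show "continuous_map (subtopology (fst Y) (topspace (fst Y))) (fst Y) (\<lambda>y. r (inl y))"
      using continuous_map_id[of "fst Y"] by (simp add: r id_def)
    show "continuous_map (subtopology (prod_topology EE I01) {p \<in> topspace (prod_topology EE I01). snd p \<in> {..<1}})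
        (fst Y) (\<lambda>p. r (q (fst p) (snd p)))"
      by (rule continuous_map_eq[OF continuous_map_from_subtopology[OF
              continuous_map_comp2[OF continuous_map_fst continuous_map_fw_Ehk(1)]]])
        (auto simp: rq)
  qed simp
  moreover have "snd Y (r u) = pJ u \<and> h (r u) = slide 0 u 0" if "u \<in> left_part" for u
  proof -
    have "u \<in> topspace J" using that by (simp add: left_part_def)
    then show ?thesis
    proof (cases rule: join_cases)
      case (mid y b \<theta> z t)
      then show ?thesis using EE_fibre by (auto simp: r slide_mid pJ_mid in_topspace_fw_Ehk)
    qed (use that in \<open>auto simp: left_part_def r slide_inl pJ_inl jJ_inl\<close>)
  qed
  ultimately show ?thesis
    by (intro fw_lifts_part[where c=0 and r=r] continuous_map_slide_left) (auto simp: left_part_def)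
qed

text \<open>Mirror image of the left case: the \<open>Z\<close> component is kept and slides start
  at parameter 1, where the path is at \<open>k z\<close>.\<close>

lemma fw_lifts_right_part: "fw_lifts (fw_restrict (J, pJ) right_part) Z K k jJ"
proof -
  define r where "r u = (THE z. u = inr z \<or> (\<exists>y b \<theta> t. u = mid y b \<theta> z t))" for u
  have r: "r (inr z) = z" "r (mid y b \<theta> z t) = z" for y b \<theta> z t
    unfolding r_def by (auto simp: inj disj)
  have rq: "r (q w t) = snd (snd w)" if "0 < t" for w t
    using that by (cases w) (auto simp: fw_join_q_def r)
  have "continuous_map (subtopology J right_part) (fst Z) r"
  proof (rule continuous_map_from_open_J[OF openin_right_part], unfold preimage_right_part)
    show "continuous_map (subtopology (fst Z) (topspace (fst Z))) (fst Z) (\<lambda>z. r (inr z))"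
      using continuous_map_id[of "fst Z"] by (simp add: r id_def)
    show "continuous_map (subtopology (prod_topology EE I01) {p \<in> topspace (prod_topology EE I01). snd p \<in> {0<..}})
        (fst Z) (\<lambda>p. r (q (fst p) (snd p)))"
      by (rule continuous_map_eq[OF continuous_map_from_subtopology[OF
              continuous_map_comp2[OF continuous_map_fst continuous_map_fw_Ehk(4)]]])
        (auto simp: rq)
  qed simp
  moreover have "snd Z (r u) = pJ u \<and> k (r u) = slide 1 u 0" if "u \<in> right_part" for u
  proof -
    have "u \<in> topspace J" using that by (simp add: right_part_def)
    then show ?thesis
    proof (cases rule: join_cases)
      case (mid y b \<theta> z t)
      then show ?thesis using EE_fibre by (auto simp: r slide_mid pJ_mid in_topspace_fw_Ehk)
    qed (use that in \<open>auto simp: right_part_def r slide_inr pJ_inr jJ_inr\<close>)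
  qed
  ultimately show ?thesis
    by (intro fw_lifts_part[where c=1 and r=r] continuous_map_slide_right) (auto simp: right_part_def)
qed

text \<open>Every point of the join misses at least one end, so the preimages of the two parts under
  the lift cover \<open>A\<close>. Over each of them the deformation of the join map onto the
  remaining end is pulled back.\<close>

lemma fw_lifts_join_split:
  assumes "fw_lifts A (J, pJ) K jJ g"
  obtains U V where "openin (fst A) U" "openin (fst A) V" "U \<union> V = topspace (fst A)"
    "fw_lifts (fw_restrict A U) Y K h g" "fw_lifts (fw_restrict A V) Z K k g"
proof -
  from assms obtain \<phi> where \<phi>: "fw_map A (J, pJ) \<phi>" and g: "fw_homotopic A K (jJ \<circ> \<phi>) g"
    unfolding fw_lifts_def by blast
  have \<phi>c: "continuous_map (fst A) J \<phi>" using \<phi> by (simp add: fw_map_def)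
  let ?P = "\<lambda>D. {x \<in> topspace (fst A). \<phi> x \<in> D}"
  have restr: "fw_map (fw_restrict A (?P D)) (fw_restrict (J, pJ) D) \<phi>" for D
    using \<phi> by (auto simp: fw_map_def continuous_map_in_subtopology continuous_map_from_subtopology)
  show thesis
  proof (rule that)
    show "openin (fst A) (?P left_part)" "openin (fst A) (?P right_part)"
      using openin_left_part openin_right_part \<phi>c by (auto intro: openin_continuous_map_preimage)
    have "left_part \<union> right_part = topspace J"
      by (auto simp: left_part_def right_part_def disj)
    then show "?P left_part \<union> ?P right_part = topspace (fst A)"
      using continuous_map_image_subset_topspace[OF \<phi>c] by blast
    show "fw_lifts (fw_restrict A (?P left_part)) Y K h g"
      by (rule fw_lifts_precompose[OF fw_lifts_left_part restr fw_homotopic_restrict[OF g]])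
    show "fw_lifts (fw_restrict A (?P right_part)) Z K k g"
      by (rule fw_lifts_precompose[OF fw_lifts_right_part restr fw_homotopic_restrict[OF g]])
  qed
qed

end

section \<open>Gluing two lifts to a lift along the join map\<close>

lemma continuous_map_clamp:
  assumes "continuous_map T euclideanreal \<mu>"
  shows "continuous_map T I01 (\<lambda>x. max 0 (min 1 (\<mu> x)))"
  unfolding continuous_map_I01 by (intro conjI ballI continuous_intros assms) auto

context fw_joinable
begin

text \<open>Where both lifts exist, both homotopies end at \<open>g\<close>, so one followed by the
  reverse of the other is a path from \<open>h (s x)\<close> to \<open>k (t x)\<close>. The join
  coordinate is \<open>\<mu>\<close> clamped to the unit interval; the margins from -1 to 0 and from
  1 to 2 are where it is constant while both lifts are available.\<close>

lemma fw_lifts_join_glue: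
  fixes A :: "('a,'b) fws"
  assumes A: "fw_space B A" and \<mu>: "continuous_map (fst A) euclideanreal \<mu>"
    and LU: "fw_lifts (fw_restrict A {x \<in> topspace (fst A). \<mu> x < 2}) Y K h g"
    and LV: "fw_lifts (fw_restrict A {x \<in> topspace (fst A). -1 < \<mu> x}) Z K k g"
  shows "fw_lifts A (J, pJ) K jJ g"
proof -
  let ?A = "fst A" and ?U = "{x \<in> topspace (fst A). \<mu> x < 2}" and ?V = "{x \<in> topspace (fst A). -1 < \<mu> x}"
  let ?M = "{x \<in> topspace (fst A). -1 < \<mu> x \<and> \<mu> x < 2}"
  obtain s H where "fw_lift (fw_restrict A ?U) Y K h g s H" using LU unfolding fw_lifts_iff by blast
  note H = fw_liftD[OF this, simplified]
  obtain t H' where "fw_lift (fw_restrict A ?V) Z K k g t H'" using LV unfolding fw_lifts_iff by blast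
  note H' = fw_liftD[OF this, simplified]
  define l where "l x = max 0 (min 1 (\<mu> x))" for x
  \<comment> \<open>First \<open>H\<close> from \<open>h (s x)\<close> to \<open>g x\<close>, then
    \<open>H'\<close> backwards from \<open>g x\<close> to \<open>k (t x)\<close>; the midpoint
    value is \<open>g x\<close>.\<close>
  define P where "P x = (\<lambda>\<tau>\<in>{0..1}. if \<tau> \<le> 1/2 then H (2*\<tau>, x) else H' (2-2*\<tau>, x))" for x
  define m where "m x = (s x, (snd A x, P x), t x)" for x
  define \<phi> where "\<phi> x = (if \<mu> x < 0 then inl (s x) else if 1 < \<mu> x then inr (t x) else q (m x) (l x))" for x
  \<comment> \<open>The path parameter moves from \<open>l x\<close> to the midpoint, where the path
    is at \<open>g x\<close>. For \<open>l x\<close> equal to 0 or 1 this is \<open>H\<close> or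
    \<open>H'\<close> itself, so the outer branches fit.\<close>
  define N where "N p = (if \<mu> (snd p) < 0 then H p else if 1 < \<mu> (snd p) then H' p
      else P (snd p) ((1 - fst p) * l (snd p) + fst p * (1/2)))" for p

  have HT: "continuous_map T (fst K) (\<lambda>a. H (\<tau> a, \<xi> a))"
    if "continuous_map T I01 \<tau>" "continuous_map T ?A \<xi>" "\<And>a. a \<in> topspace T \<Longrightarrow> \<mu> (\<xi> a) < 2" for T :: "'c topology" and \<tau> \<xi>
    by (rule continuous_map_comp2[OF _ H(3)], intro continuous_map_pairedI that continuous_map_into_subtopology)
      (use that continuous_map_image_subset_topspace[OF that(2)] in auto)
  have HT': "continuous_map T (fst K) (\<lambda>a. H' (\<tau> a, \<xi> a))"
    if "continuous_map T I01 \<tau>" "continuous_map T ?A \<xi>" "\<And>a. a \<in> topspace T \<Longrightarrow> -1 < \<mu> (\<xi> a)" for T :: "'c topology" and \<tau> \<xi>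
    by (rule continuous_map_comp2[OF _ H'(3)], intro continuous_map_pairedI that continuous_map_into_subtopology)
      (use that continuous_map_image_subset_topspace[OF that(2)] in auto)

  let ?AM = "subtopology ?A ?M"
  let ?T = "prod_topology ?AM I01"
  have xi: "continuous_map ?T ?A fst"
    using continuous_map_into_fulltopology[OF continuous_map_fst[of ?AM I01]] .
  have sn: "continuous_map ?T euclideanreal snd" by (rule continuous_map_fst_snd_I01)
  have PT: "continuous_map ?T (fst K) (\<lambda>a. if snd a \<le> 1/2 then H (2 * snd a, fst a) else H' (2 - 2 * snd a, fst a))"
  proof (rule continuous_map_cases_le[OF sn])
    show "continuous_map (subtopology ?T {a \<in> topspace ?T. snd a \<le> 1/2}) (fst K) (\<lambda>a. H (2 * snd a, fst a))"
    proof (rule HT)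
      show "continuous_map (subtopology ?T {a \<in> topspace ?T. snd a \<le> 1/2}) I01 (\<lambda>a. 2 * snd a)"
        unfolding continuous_map_I01
        by (intro conjI continuous_intros continuous_map_from_subtopology sn) auto
    qed (auto intro: continuous_map_from_subtopology xi)
    show "continuous_map (subtopology ?T {a \<in> topspace ?T. 1/2 \<le> snd a}) (fst K) (\<lambda>a. H' (2 - 2 * snd a, fst a))"
    proof (rule HT')
      show "continuous_map (subtopology ?T {a \<in> topspace ?T. 1/2 \<le> snd a}) I01 (\<lambda>a. 2 - 2 * snd a)"
        unfolding continuous_map_I01
        by (intro conjI continuous_intros continuous_map_from_subtopology sn) auto
    qed (auto intro: continuous_map_from_subtopology xi)
    show "H (2 * snd a, fst a) = H' (2 - 2 * snd a, fst a)" if "a \<in> topspace ?T" "snd a = 1/2" for a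
      using that H(5)[of "fst a"] H'(5)[of "fst a"] by (cases a) (auto simp: field_simps)
  qed simp
  have Pc: "continuous_map ?AM (compact_open (fst K)) P"
    using continuous_map_curry[OF PT] unfolding P_def fst_conv snd_conv .
  have Pp: "continuous_map I01 (fst K) (P x)" if "x \<in> ?M" for x
  proof -
    have "continuous_map I01 ?T (\<lambda>\<tau>. (x, \<tau>))"
      using that continuous_map_id[of I01] by (intro continuous_map_pairedI) (auto simp: id_def)
    from continuous_map_comp2[OF this PT]
    show ?thesis by (rule continuous_map_eq) (auto simp: P_def)
  qed
  have Pv: "snd K (P x \<tau>) = snd A x" if "x \<in> ?M" "0 \<le> \<tau>" "\<tau> \<le> 1" for x \<tau>
    using that H(6)[of "2*\<tau>" x] H'(6)[of "2-2*\<tau>" x] by (auto simp: P_def)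
  have P0: "h (s x) = P x 0 \<and> k (t x) = P x 1" if "x \<in> ?M" for x
    using that H(4) H'(4) by (auto simp: P_def)
  have mc: "continuous_map ?AM EE m"
    unfolding m_def
  proof (rule continuous_map_into_fw_Ehk)
    show "continuous_map ?AM (fst Y) s" by (rule continuous_map_from_subtopology_mono[OF H(1)]) auto
    show "continuous_map ?AM (fst Z) t" by (rule continuous_map_from_subtopology_mono[OF H'(1)]) auto
    show "continuous_map ?AM B (snd A)"
      using A by (simp add: fw_space_def continuous_map_from_subtopology)
    show "continuous_map ?AM (compact_open (fst K)) P" by (rule Pc)
  qed (use Pp Pv P0 in \<open>auto simp: P_def\<close>)
  have m_in: "m x \<in> topspace EE" if "x \<in> ?M" for x
    using continuous_map_image_subset_topspace[OF mc] that by fastforce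
  have l01: "0 \<le> l x" "l x \<le> 1" for x by (auto simp: l_def)
  have l01c: "continuous_map ?A I01 l" unfolding l_def by (rule continuous_map_clamp[OF \<mu>])

  have \<phi>c: "continuous_map ?A J \<phi>"
    unfolding \<phi>_def
  proof (rule continuous_map_paste3[OF \<mu>])
    show "continuous_map (subtopology ?A {x \<in> topspace ?A. \<mu> x < 0}) J (\<lambda>x. inl (s x))"
      by (rule continuous_map_comp2[OF continuous_map_from_subtopology_mono[OF H(1)] continuous_map_inl]) auto
    show "continuous_map (subtopology ?A {x \<in> topspace ?A. 1 < \<mu> x}) J (\<lambda>x. inr (t x))"
      by (rule continuous_map_comp2[OF continuous_map_from_subtopology_mono[OF H'(1)] continuous_map_inr]) auto
    have "continuous_map ?AM (prod_topology EE I01) (\<lambda>x. (m x, l x))"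
      by (intro continuous_map_pairedI mc continuous_map_from_subtopology[OF l01c])
    from continuous_map_comp2[OF this continuous_map_q]
    show "continuous_map ?AM J (\<lambda>x. q (m x) (l x))" by simp
  \<comment> \<open>On the overlap strips \<open>l\<close> is 0 or 1, and there \<open>q\<close> is
    already \<open>inl (s x)\<close> or \<open>inr (t x)\<close>.\<close>
  qed (auto simp: l_def m_def q_simps)

  have \<phi>f: "pJ (\<phi> x) = snd A x" if x: "x \<in> topspace ?A" for x
  proof -
    have "s x \<in> topspace (fst Y)" if "\<mu> x < 0"
      using continuous_map_image_subset_topspace[OF H(1)] x that by fastforce
    moreover have "t x \<in> topspace (fst Z)" if "1 < \<mu> x"
      using continuous_map_image_subset_topspace[OF H'(1)] x that by fastforce
    ultimately show ?thesis using x H(2) H'(2) m_in[of x] l01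
      by (auto simp: \<phi>_def pJ_inl pJ_inr pJ_q m_def)
  qed

  let ?IA = "prod_topology I01 ?A"
  have \<mu>s: "continuous_map ?IA euclideanreal (\<lambda>p. \<mu> (snd p))"
    by (rule continuous_map_comp2[OF continuous_map_snd \<mu>])
  have Nc: "continuous_map ?IA (fst K) N"
    unfolding N_def
  proof (rule continuous_map_paste3[OF \<mu>s])
    have "continuous_map (subtopology ?IA {p \<in> topspace ?IA. \<mu> (snd p) < 0}) (fst K) (\<lambda>p. H (fst p, snd p))"
      by (rule HT) (auto intro: continuous_map_from_subtopology continuous_map_fst continuous_map_snd)
    then show "continuous_map (subtopology ?IA {p \<in> topspace ?IA. \<mu> (snd p) < 0}) (fst K) H" by simp
    have "continuous_map (subtopology ?IA {p \<in> topspace ?IA. 1 < \<mu> (snd p)}) (fst K) (\<lambda>p. H' (fst p, snd p))"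
      by (rule HT') (auto intro: continuous_map_from_subtopology continuous_map_fst continuous_map_snd)
    then show "continuous_map (subtopology ?IA {p \<in> topspace ?IA. 1 < \<mu> (snd p)}) (fst K) H'" by simp
    let ?S = "subtopology ?IA {p \<in> topspace ?IA. -1 < \<mu> (snd p) \<and> \<mu> (snd p) < 2}"
    have sM: "continuous_map ?S ?AM snd"
      by (rule continuous_map_into_subtopology) (auto intro: continuous_map_from_subtopology continuous_map_snd)
    have lc: "continuous_map ?S euclideanreal (\<lambda>p. l (snd p))"
      using l01c unfolding continuous_map_I01
      by (intro continuous_map_from_subtopology continuous_map_comp2[OF continuous_map_snd]) blast
    show "continuous_map ?S (fst K) (\<lambda>p. P (snd p) ((1 - fst p) * l (snd p) + fst p * (1/2)))"
    proof (rule continuous_map_eval[OF continuous_map_comp2[OF sM Pc]])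
      show "continuous_map ?S I01 (\<lambda>p. (1 - fst p) * l (snd p) + fst p * (1/2))"
        unfolding continuous_map_I01
      proof (intro conjI ballI)
        show "continuous_map ?S euclideanreal (\<lambda>p. (1 - fst p) * l (snd p) + fst p * (1/2))"
          by (intro continuous_intros lc continuous_map_from_subtopology continuous_map_fst_snd_I01)
        fix p assume "p \<in> topspace ?S"
        then show "0 \<le> (1 - fst p) * l (snd p) + fst p * (1/2)" "(1 - fst p) * l (snd p) + fst p * (1/2) \<le> 1"
          using convex_01[of "fst p" "l (snd p)" "1/2"] l01 by auto
      qed
    qed (use Pp in auto)
    fix p assume p: "p \<in> topspace ?IA"
    then have p': "0 \<le> fst p" "fst p \<le> 1" "snd p \<in> topspace ?A" by auto
    show "P (snd p) ((1 - fst p) * l (snd p) + fst p * (1/2)) = H p" if "\<mu> (snd p) < 0"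
      using that p' by (simp add: l_def P_def)
    show "P (snd p) ((1 - fst p) * l (snd p) + fst p * (1/2)) = H' p" if "1 < \<mu> (snd p)" "\<mu> (snd p) < 2"
    proof (cases "fst p = 1")
      \<comment> \<open>The parameter is exactly 1/2, where \<open>P\<close> takes its
        \<open>H\<close> branch; it equals the \<open>H'\<close> branch because both homotopies end
        at \<open>g\<close>.\<close>
      case True
      then show ?thesis using that p' H(5)[of "snd p"] H'(5)[of "snd p"]
        by (cases p) (simp add: l_def P_def)
    next
      case False
      then show ?thesis using that p' by (cases p) (simp add: l_def P_def)
    qed
  qed
  have "fw_lift A (J, pJ) K jJ g \<phi> N"
    unfolding fw_lift_def fw_map_def fst_conv snd_conv
  proof (intro conjI ballI \<phi>c \<phi>f Nc)
    fix x assume x: "x \<in> topspace ?A"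
    have "s x \<in> topspace (fst Y)" if "\<mu> x < 0"
      using continuous_map_image_subset_topspace[OF H(1)] x that by fastforce
    moreover have "t x \<in> topspace (fst Z)" if "1 < \<mu> x"
      using continuous_map_image_subset_topspace[OF H'(1)] x that by fastforce
    ultimately show "N (0, x) = jJ (\<phi> x)"
      using x H(4) H'(4) m_in[of x] l01 by (auto simp: N_def \<phi>_def jJ_inl jJ_inr jJ_q m_def)
    show "N (1, x) = g x" using x H(5) H'(5) by (auto simp: N_def P_def)
    fix r :: real assume r: "r \<in> {0..1}"
    show "snd K (N (r, x)) = snd A x"
      using x r H(6) H'(6) Pv[of x "(1 - r) * l x + r * (1/2)"] convex_01[of r "l x" "1/2"] l01[of x]
      by (auto simp: N_def)
  qed
  then show ?thesis unfolding fw_lifts_iff by blast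
qed

end

section \<open>Open covers and the inductive constructions\<close>

text \<open>The combinatorial core shared by both constructions: \<open>S\<close> stands for a lift
  along \<open>f\<close> and \<open>L n\<close> for a lift at stage \<open>n\<close>. Splitting is
  asked for open sets, from which the cover is unwound, and gluing for closed sets, over which
  normality is inherited.\<close>

lemma open_cover_recursion:
  fixes X :: "'a topology" and S :: "'a set \<Rightarrow> bool" and L :: "nat \<Rightarrow> 'a set \<Rightarrow> bool"
  assumes X: "normal_space X"
    and L0: "\<And>W. W \<subseteq> topspace X \<Longrightarrow> L 0 W \<longleftrightarrow> S W"
    and split: "\<And>n W. \<lbrakk>openin X W; L (Suc n) W\<rbrakk> \<Longrightarrow>
      \<exists>U V. openin X U \<and> openin X V \<and> W \<subseteq> U \<union> V \<and> L n U \<and> S V"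
    and glue: "\<And>n W \<mu>. \<lbrakk>closedin X W; continuous_map (subtopology X W) euclideanreal \<mu>;
      L n {x \<in> W. \<mu> x < 2}; S {x \<in> W. -1 < \<mu> x}\<rbrakk> \<Longrightarrow> L (Suc n) W"
    and Smono: "\<And>V W. S W \<Longrightarrow> V \<subseteq> W \<Longrightarrow> S V" and Lmono: "\<And>n V W. L n W \<Longrightarrow> V \<subseteq> W \<Longrightarrow> L n V"
  shows "L n (topspace X) \<longleftrightarrow> (\<exists>U. (\<forall>i\<le>n. openin X (U i) \<and> S (U i)) \<and> topspace X \<subseteq> (\<Union>i\<le>n. U i))"
proof
  \<comment> \<open>Generalised to every open \<open>W\<close>, since the induction continues with
    an open piece.\<close>
  have "\<exists>U. (\<forall>i\<le>n. openin X (U i) \<and> S (U i)) \<and> W \<subseteq> (\<Union>i\<le>n. U i)" if "openin X W" "L n W" for W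
    using that
  proof (induction n arbitrary: W)
    case 0
    then show ?case using L0[OF openin_subset[OF 0(1)]] by (intro exI[of _ "\<lambda>_. W"]) auto
  next
    case (Suc n)
    obtain P V where PV: "openin X P" "openin X V" "W \<subseteq> P \<union> V" "L n P" "S V"
      using split[OF Suc.prems] by blast
    obtain U where U: "\<forall>i\<le>n. openin X (U i) \<and> S (U i)" "P \<subseteq> (\<Union>i\<le>n. U i)"
      using Suc.IH[OF PV(1,4)] by blast
    show ?case
    \<comment> \<open>The piece that is split off becomes the last member of the cover.\<close>
    proof (intro exI[of _ "U(Suc n := V)"] conjI)
      show "\<forall>i\<le>Suc n. openin X ((U(Suc n := V)) i) \<and> S ((U(Suc n := V)) i)"
        using U(1) PV by (auto simp: le_Suc_eq)
      show "W \<subseteq> (\<Union>i\<le>Suc n. (U(Suc n := V)) i)"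
      proof
        fix x assume "x \<in> W"
        then consider "x \<in> V" | i where "i \<le> n" "x \<in> U i" using PV(3) U(2) by blast
        then show "x \<in> (\<Union>i\<le>Suc n. (U(Suc n := V)) i)"
        proof cases
          case 1 then show ?thesis by (intro UN_I[of "Suc n"]) auto
        next
          case 2 then show ?thesis by (intro UN_I[of i]) auto
        qed
      qed
    qed
  qed
  then show "L n (topspace X) \<Longrightarrow> \<exists>U. (\<forall>i\<le>n. openin X (U i) \<and> S (U i)) \<and> topspace X \<subseteq> (\<Union>i\<le>n. U i)"
    by blast
next
  assume "\<exists>U. (\<forall>i\<le>n. openin X (U i) \<and> S (U i)) \<and> topspace X \<subseteq> (\<Union>i\<le>n. U i)"
  then obtain U where "\<And>i. i \<le> n \<Longrightarrow> openin X (U i) \<and> S (U i)" "topspace X \<subseteq> (\<Union>i\<le>n. U i)"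
    by blast
  \<comment> \<open>Generalised to every closed \<open>W\<close>, so that the induction stays among
    normal subspaces of \<open>X\<close>.\<close>
  moreover have "L n W" if "closedin X W" "\<And>i. i \<le> n \<Longrightarrow> openin X (U i) \<and> S (U i)" "W \<subseteq> (\<Union>i\<le>n. U i)" for W
    using that
  proof (induction n arbitrary: W)
    case 0
    then show ?case using L0[OF closedin_subset[OF 0(1)]] Smono[of "U 0" W] by auto
  next
    case (Suc n)
    let ?P = "\<Union>i\<le>n. U i" and ?V = "U (Suc n)"
    have W: "W \<subseteq> topspace X" by (rule closedin_subset[OF Suc.prems(1)])
    have oP: "openin X ?P" using Suc.prems(2) by auto
    have oV: "openin X ?V" using Suc.prems(2) by auto
    have cl: "closedin (subtopology X W) (W - Q)" if "openin X Q" for Q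
      using closedin_subtopology_Int_closed[OF closedin_diff[OF closedin_topspace that], of W] W
      by (simp add: Int_Diff[symmetric] Int_absorb2)
    have nW: "normal_space (subtopology X W)"
      by (rule normal_space_closed_subtopology[OF X Suc.prems(1)])
    have dj: "disjnt (W - ?V) (W - ?P)"
      using Suc.prems(3) by (auto simp: disjnt_def atMost_Suc)
    \<comment> \<open>The value -1 off the last set forces points with \<open>-1 < \<mu> x\<close>
      into that set. The value 3 exceeds 2 strictly, so even the closed condition
      \<open>\<mu> x \<le> 2\<close> forces points into the union of the others, and the induction
      hypothesis meets a closed set.\<close>
    obtain \<mu> :: "'a \<Rightarrow> real" where \<mu>: "continuous_map (subtopology X W) euclideanreal \<mu>"
      "\<mu> ` (W - ?V) \<subseteq> {-1}" "\<mu> ` (W - ?P) \<subseteq> {3}"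
      using Urysohn_lemma_alt[OF nW cl[OF oV] cl[OF oP] dj, of "-1" 3] by blast
    have "closedin (subtopology X W) {x \<in> topspace (subtopology X W). \<mu> x \<in> {..2}}"
      by (rule closedin_continuous_map_preimage[OF \<mu>(1)]) (simp flip: closed_closedin)
    moreover have "{x \<in> topspace (subtopology X W). \<mu> x \<in> {..2}} = {x \<in> W. \<mu> x \<le> 2}" using W by auto
    ultimately have "closedin X {x \<in> W. \<mu> x \<le> 2}"
      using closedin_trans_full Suc.prems(1) by metis
    moreover have "{x \<in> W. \<mu> x \<le> 2} \<subseteq> ?P"
    proof
      fix x assume x: "x \<in> {x \<in> W. \<mu> x \<le> 2}"
      show "x \<in> ?P"
      proof (rule ccontr)
        assume "x \<notin> ?P"
        then have "\<mu> x \<in> {3}" using \<mu>(3) x by blast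
        then show False using x by simp
      qed
    qed
    ultimately have "L n {x \<in> W. \<mu> x \<le> 2}" using Suc.IH Suc.prems(2) by simp
    then have "L n {x \<in> W. \<mu> x < 2}" by (rule Lmono) auto
    moreover have "S {x \<in> W. -1 < \<mu> x}"
    proof (rule Smono[of ?V])
      show "S ?V" using Suc.prems(2) by blast
      show "{x \<in> W. -1 < \<mu> x} \<subseteq> ?V"
      proof
        fix x assume x: "x \<in> {x \<in> W. -1 < \<mu> x}"
        show "x \<in> ?V"
        proof (rule ccontr)
          assume "x \<notin> ?V"
          then have "\<mu> x \<in> {-1}" using \<mu>(2) x by blast
          then show False using x by simp
        qed
      qed
    qed
    ultimately show ?case by (rule glue[OF Suc.prems(1) \<mu>(1)])
  qed
  ultimately show "L n (topspace X)" by blast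
qed

section \<open>Sectional category as a covering condition\<close>

text \<open>A cover can be padded by repeating its last member, so the covering condition is upward
  closed in \<open>n\<close> and bounding the least index amounts to the condition at
  \<open>n\<close>.\<close>

lemma fw_secat_le_iff:
  "fw_secat E X f \<le> enat n \<longleftrightarrow>
    (\<exists>U. (\<forall>i\<le>n. fw_sectional E X f (U i)) \<and> topspace (fst X) \<subseteq> (\<Union>i\<le>n. U i))"
proof -
  define P where "P = (\<lambda>n::nat. \<exists>U. (\<forall>i\<le>n. fw_sectional E X f (U i)) \<and> topspace (fst X) \<subseteq> (\<Union>i\<le>n. U i))"
  have secat: "fw_secat E X f = (if \<exists>n. P n then enat (LEAST n. P n) else \<infinity>)"
    unfolding fw_secat_def P_def Let_def ..
  have mono: "P n" if "P m" "m \<le> n" for m n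
  proof -
    from that(1) obtain U where U: "\<forall>i\<le>m. fw_sectional E X f (U i)" "topspace (fst X) \<subseteq> (\<Union>i\<le>m. U i)"
      unfolding P_def by blast
    have "(\<Union>i\<le>m. U i) \<subseteq> (\<Union>i\<le>n. U (min i m))"
    proof
      fix x assume "x \<in> (\<Union>i\<le>m. U i)"
      then obtain i where "i \<le> m" "x \<in> U i" by blast
      then show "x \<in> (\<Union>i\<le>n. U (min i m))" using that(2) by (intro UN_I[of i]) (auto simp: min_def)
    qed
    then show ?thesis unfolding P_def using U by (intro exI[of _ "\<lambda>i. U (min i m)"]) auto
  qed
  have "fw_secat E X f \<le> enat n \<longleftrightarrow> P n"
  proof
    assume "fw_secat E X f \<le> enat n"
    then have "\<exists>n. P n" "(LEAST n. P n) \<le> n" unfolding secat by (auto split: if_splits)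
    then show "P n" using mono LeastI_ex by metis
  next
    assume "P n" then show "fw_secat E X f \<le> enat n" unfolding secat using Least_le[of P n] by auto
  qed
  then show ?thesis unfolding P_def .
qed

lemma fw_sectional_iff:
  "fw_sectional E X f U \<longleftrightarrow> openin (fst X) U \<and> fw_lifts (fw_restrict X U) E X f id"
  unfolding fw_sectional_def fw_lifts_def ..

lemma fw_space_restrict: "fw_space B A \<Longrightarrow> fw_space B (fw_restrict A U)"
  unfolding fw_space_def by (simp add: continuous_map_from_subtopology)

text \<open>A commuting square carries lifts to lifts: \<open>\<psi>\<close> is applied to the lift
  and \<open>c\<close> to the homotopy. It is used with coordinate projections as well as with maps
  into products and representing types.\<close>

lemma fw_lifts_map:
  assumes L: "fw_lifts A Y K h g" and \<psi>: "fw_map Y Y' \<psi>" and c: "fw_map K K' c"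
    and h': "\<And>y. y \<in> topspace (fst Y) \<Longrightarrow> h' (\<psi> y) = c (h y)"
    and g': "\<And>x. x \<in> topspace (fst A) \<Longrightarrow> g' x = c (g x)"
  shows "fw_lifts A Y' K' h' g'"
proof -
  from L obtain \<phi> H where "fw_lift A Y K h g \<phi> H" unfolding fw_lifts_iff by blast
  note H = fw_liftD[OF this]
  have \<phi>in: "\<phi> x \<in> topspace (fst Y)" if "x \<in> topspace (fst A)" for x
    using continuous_map_image_subset_topspace[OF H(1)] that by blast
  have Hin: "H (t,x) \<in> topspace (fst K)" if "x \<in> topspace (fst A)" "t \<in> {0..1}" for t x
    using continuous_map_image_subset_topspace[OF H(3)] that by fastforce
  have "continuous_map (fst A) (fst Y') (\<lambda>x. \<psi> (\<phi> x))"
    using \<psi> by (intro continuous_map_comp2[OF H(1)]) (simp add: fw_map_def)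
  moreover have "continuous_map (prod_topology I01 (fst A)) (fst K') (\<lambda>p. c (H p))"
    using c by (intro continuous_map_comp2[OF H(3)]) (simp add: fw_map_def)
  ultimately have "fw_lift A Y' K' h' g' (\<lambda>x. \<psi> (\<phi> x)) (\<lambda>p. c (H p))"
    unfolding fw_lift_def fw_map_def
    using H(2,4-6) \<phi>in Hin h' g' \<psi> c by (auto simp: fw_map_def)
  then show ?thesis unfolding fw_lifts_iff by blast
qed

lemma fw_map_id: "fw_map X X (\<lambda>x. x)"
  using continuous_map_id[of "fst X"] by (simp add: fw_map_def id_def)

section \<open>Final topologies, for stage zero of both constructions\<close>

lemma openin_final_top:
  "openin (final_top X c) U \<longleftrightarrow> U \<subseteq> c ` topspace X \<and> openin X {x \<in> topspace X. c x \<in> U}"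
  (is "_ \<longleftrightarrow> ?O U")
proof -
  have "istopology ?O"
    unfolding istopology_def
  proof (intro conjI allI impI)
    fix U V assume UV: "?O U" "?O V"
    have "openin X ({x \<in> topspace X. c x \<in> U} \<inter> {x \<in> topspace X. c x \<in> V})" using UV by blast
    then show "openin X {x \<in> topspace X. c x \<in> U \<inter> V}" by (rule back_subst) auto
  next
    fix \<U> assume U: "\<forall>U\<in>\<U>. ?O U"
    then have "openin X (\<Union>U\<in>\<U>. {x \<in> topspace X. c x \<in> U})" by blast
    then show "openin X {x \<in> topspace X. c x \<in> \<Union>\<U>}" by (rule back_subst) auto
  qed blast+
  then show ?thesis unfolding final_top_def by simp
qed

lemma topspace_final_top: "topspace (final_top X c) = c ` topspace X"
proof (rule antisym)
  show "topspace (final_top X c) \<subseteq> c ` topspace X"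
    using openin_topspace[of "final_top X c"] unfolding openin_final_top by blast
  have "{x \<in> topspace X. c x \<in> c ` topspace X} = topspace X" by blast
  then show "c ` topspace X \<subseteq> topspace (final_top X c)"
    by (intro openin_subset) (simp add: openin_final_top)
qed

lemma continuous_map_final_top: "continuous_map X (final_top X c) c"
  unfolding continuous_map topspace_final_top openin_final_top by blast

lemma continuous_map_from_final_top:
  assumes "continuous_map X T (\<lambda>x. F (c x))" shows "continuous_map (final_top X c) T F"
  unfolding continuous_map topspace_final_top openin_final_top
proof (intro conjI allI impI)
  show "F ` c ` topspace X \<subseteq> topspace T" using assms unfolding continuous_map by auto
  fix U assume "openin T U"
  from openin_continuous_map_preimage[OF assms this]
  show "openin X {x \<in> topspace X. c x \<in> {u \<in> c ` topspace X. F u \<in> U}}" by (rule back_subst) auto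
qed auto

text \<open>For an injective constructor the final topology is a homeomorphic copy of
  \<open>E\<close>, with inverse \<open>inv c\<close>; lifts are carried across in both
  directions.\<close>

lemma fw_lifts_final_top:
  assumes c: "inj c" and p: "\<And>e. e \<in> topspace (fst E) \<Longrightarrow> p (c e) = snd E e"
  shows "fw_lifts A (final_top (fst E) c, p) K j g \<longleftrightarrow> fw_lifts A E K (\<lambda>e. j (c e)) g"
proof
  have "continuous_map (final_top (fst E) c) (fst E) (inv c)"
    by (rule continuous_map_from_final_top) (use c fw_map_id[of E] in \<open>simp add: fw_map_def\<close>)
  then have *: "fw_map (final_top (fst E) c, p) E (inv c)"
    using c p by (auto simp: fw_map_def topspace_final_top)
  show "fw_lifts A E K (\<lambda>e. j (c e)) g" if "fw_lifts A (final_top (fst E) c, p) K j g"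
    by (rule fw_lifts_map[OF that * fw_map_id]) (use c in \<open>auto simp: topspace_final_top\<close>)
  have *: "fw_map E (final_top (fst E) c, p) c"
    using continuous_map_final_top p by (auto simp: fw_map_def)
  show "fw_lifts A (final_top (fst E) c, p) K j g" if "fw_lifts A E K (\<lambda>e. j (c e)) g"
    by (rule fw_lifts_map[OF that * fw_map_id]) auto
qed

locale fw_setting =
  fixes B :: "'b topology" and E :: "('e,'b) fws" and X :: "('x,'b) fws" and f :: "'e \<Rightarrow> 'x"
  assumes E: "fw_space B E" and X: "fw_space B X" and f: "fw_map E X f"
begin

text \<open>The cover recursion phrased for fibrewise spaces, with \<open>\<Lambda> n\<close> as the
  lift condition at stage \<open>n\<close>. The premise \<open>A = fw_restrict X W\<close> records
  that only subspaces of \<open>X\<close> occur, on which the diagonal is a fibrewise map.\<close>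

lemma fw_secat_le_iff_recursion:
  fixes \<Lambda> :: "nat \<Rightarrow> ('x,'b) fws \<Rightarrow> bool"
  assumes normal: "normal_space (fst X)"
    and base: "\<And>W. \<Lambda> 0 (fw_restrict X W) \<longleftrightarrow> fw_lifts (fw_restrict X W) E X f id"
    and split: "\<And>n W A. \<lbrakk>A = fw_restrict X W; \<Lambda> (Suc n) A\<rbrakk> \<Longrightarrow> \<exists>U V. openin (fst A) U \<and> openin (fst A) V \<and>
      U \<union> V = topspace (fst A) \<and> \<Lambda> n (fw_restrict A U) \<and> fw_lifts (fw_restrict A V) E X f id"
    and glue: "\<And>n W A \<mu>. \<lbrakk>A = fw_restrict X W; continuous_map (fst A) euclideanreal \<mu>;
      \<Lambda> n (fw_restrict A {x \<in> topspace (fst A). \<mu> x < 2});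
      fw_lifts (fw_restrict A {x \<in> topspace (fst A). -1 < \<mu> x}) E X f id\<rbrakk> \<Longrightarrow> \<Lambda> (Suc n) A"
    and mono: "\<And>n V W. \<Lambda> n (fw_restrict X W) \<Longrightarrow> V \<subseteq> W \<Longrightarrow> \<Lambda> n (fw_restrict X V)"
  shows "fw_secat E X f \<le> enat n \<longleftrightarrow> \<Lambda> n X"
proof -
  define L where "L n W \<longleftrightarrow> \<Lambda> n (fw_restrict X W)" for n W
  define S where "S W \<longleftrightarrow> fw_lifts (fw_restrict X W) E X f id" for W
  have "L n (topspace (fst X)) \<longleftrightarrow>
      (\<exists>U. (\<forall>i\<le>n. openin (fst X) (U i) \<and> S (U i)) \<and> topspace (fst X) \<subseteq> (\<Union>i\<le>n. U i))"
  proof (rule open_cover_recursion[OF normal])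
    show "L 0 W \<longleftrightarrow> S W" for W unfolding L_def S_def by (rule base)
    show "S W \<Longrightarrow> V \<subseteq> W \<Longrightarrow> S V" for V W unfolding S_def by (rule fw_lifts_restrict_mono)
    show "L n W \<Longrightarrow> V \<subseteq> W \<Longrightarrow> L n V" for n V W unfolding L_def by (rule mono)
  next
    fix n W assume W: "openin (fst X) W" "L (Suc n) W"
    from split[OF refl W(2)[unfolded L_def]] obtain U V where "openin (subtopology (fst X) W) U"
      "openin (subtopology (fst X) W) V" "U \<union> V = topspace (subtopology (fst X) W)"
      "\<Lambda> n (fw_restrict (fw_restrict X W) U)" "fw_lifts (fw_restrict (fw_restrict X W) V) E X f id"
      by auto
    \<comment> \<open>Sets open in the open subspace \<open>W\<close> are open in \<open>X\<close>,
      and restricting twice is restricting to the smaller set.\<close>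
    then show "\<exists>U V. openin (fst X) U \<and> openin (fst X) V \<and> W \<subseteq> U \<union> V \<and> L n U \<and> S V"
      using W(1) openin_subset[OF W(1)] unfolding L_def S_def
      by (intro exI[of _ U] exI[of _ V])
        (auto simp: openin_open_subtopology subtopology_subtopology Int_absorb1)
  next
    fix n W \<mu>
    assume W: "closedin (fst X) W" and \<mu>: "continuous_map (subtopology (fst X) W) euclideanreal \<mu>"
      and "L n {x \<in> W. \<mu> x < 2}" "S {x \<in> W. -1 < \<mu> x}"
    moreover have "topspace (fst X) \<inter> W = W" using closedin_subset[OF W] by blast
    moreover have "W \<inter> {x \<in> W. P x} = {x \<in> W. P x}" for P by blast
    ultimately show "L (Suc n) W"
      unfolding L_def S_def
      by (intro glue[OF refl, where \<mu>=\<mu>]) (simp_all add: subtopology_subtopology)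
  qed
  then show ?thesis
    unfolding L_def S_def fw_secat_le_iff fw_sectional_iff by simp
qed

section \<open>Fibrewise Ganea maps\<close>

abbreviation "G \<equiv> ganea_space B E X f"
abbreviation "p \<equiv> ganea_map B E X f"

lemma ganea_joinable_step:
  assumes "fw_space B (G n)" "fw_map (G n) X (p n)"
  shows "fw_joinable B (G n) E X (p n) f GL GE GM"
  by unfold_locales (use assms E f in auto)

lemma ganea_Suc:
  "fw_ganea B E X f (Suc n) = fw_join B (G n) E X (p n) f GL GE GM"
  by (simp add: ganea_space_def ganea_map_def split_beta)

text \<open>Identifies a recursion step with the join of the locale, so that splitting and gluing
  apply to it.\<close>

lemma ganea_join_eq:
  assumes "fw_joinable B (G n) E X (p n) f GL GE GM"
  shows "G (Suc n) = (fw_joinable.J B (G n) E X (p n) f GL GE GM, fw_joinable.pJ B (G n) E X (p n) f GL GE GM)"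
    and "p (Suc n) = fw_joinable.jJ B (G n) E X (p n) f GL GE GM"
  unfolding ganea_space_def[of B E X f "Suc n"] ganea_map_def[of B E X f "Suc n"] ganea_Suc
    fw_joinable.J_def[OF assms] fw_joinable.pJ_def[OF assms] fw_joinable.jJ_def[OF assms] by auto

text \<open>Both facts are carried through the induction together, since forming the next join
  requires both.\<close>

lemma ganea_fw: "fw_space B (G n) \<and> fw_map (G n) X (p n)"
proof (induction n)
  case 0
  have "continuous_map (final_top (fst E) GE) B (\<lambda>u. case u of GE e \<Rightarrow> snd E e | _ \<Rightarrow> undefined)"
    using E by (intro continuous_map_from_final_top) (simp add: fw_space_def)
  moreover have "continuous_map (final_top (fst E) GE) (fst X) (\<lambda>u. case u of GE e \<Rightarrow> f e | _ \<Rightarrow> undefined)"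
    using f by (intro continuous_map_from_final_top) (simp add: fw_map_def)
  ultimately show ?case
    using f by (auto simp: ganea_space_def ganea_map_def fw_space_def fw_map_def topspace_final_top)
next
  case (Suc n)
  then have J: "fw_joinable B (G n) E X (p n) f GL GE GM" by (intro ganea_joinable_step) auto
  show ?case
    unfolding ganea_join_eq[OF J] using fw_joinable.fw_space_join[OF J] fw_joinable.fw_map_join[OF J] by simp
qed

lemma ganea_joinable: "fw_joinable B (G n) E X (p n) f GL GE GM"
  using ganea_fw by (intro ganea_joinable_step) auto

lemma ganea_lifts_0: "fw_lifts A (G 0) X (p 0) g \<longleftrightarrow> fw_lifts A E X f g"
  using fw_lifts_final_top[of GE E "\<lambda>u. case u of GE e \<Rightarrow> snd E e | _ \<Rightarrow> undefined" A X
      "\<lambda>u. case u of GE e \<Rightarrow> f e | _ \<Rightarrow> undefined" g]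
  by (simp add: ganea_space_def ganea_map_def inj_def)

text \<open>The previous Ganea space is the left factor of the join and \<open>E\<close> the right
  one, which is the order in which the recursion splits and glues.\<close>

theorem fw_secat_le_iff_ganea:
  assumes "normal_space (fst X)"
  shows "fw_secat E X f \<le> enat n \<longleftrightarrow> fw_lifts X (G n) X (p n) id"
proof (rule fw_secat_le_iff_recursion[OF assms, where \<Lambda> = "\<lambda>n A. fw_lifts A (G n) X (p n) id"])
  show "fw_lifts (fw_restrict X W) (G 0) X (p 0) id \<longleftrightarrow> fw_lifts (fw_restrict X W) E X f id" for W
    by (rule ganea_lifts_0)
  show "fw_lifts (fw_restrict X W) (G n) X (p n) id \<Longrightarrow> V \<subseteq> W \<Longrightarrow> fw_lifts (fw_restrict X V) (G n) X (p n) id"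
    for n V W by (rule fw_lifts_restrict_mono)
next
  fix n W and A :: "('x,'b) fws"
  assume "A = fw_restrict X W" and "fw_lifts A (G (Suc n)) X (p (Suc n)) id"
  then obtain U V where "openin (fst A) U" "openin (fst A) V" "U \<union> V = topspace (fst A)"
    "fw_lifts (fw_restrict A U) (G n) X (p n) id" "fw_lifts (fw_restrict A V) E X f id"
    unfolding ganea_join_eq[OF ganea_joinable]
    by (elim fw_joinable.fw_lifts_join_split[OF ganea_joinable])
  then show "\<exists>U V. openin (fst A) U \<and> openin (fst A) V \<and> U \<union> V = topspace (fst A) \<and>
      fw_lifts (fw_restrict A U) (G n) X (p n) id \<and> fw_lifts (fw_restrict A V) E X f id"
    by iprover
next
  fix n W and A :: "('x,'b) fws" and \<mu>
  assume A: "A = fw_restrict X W" and L: "continuous_map (fst A) euclideanreal \<mu>"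
    "fw_lifts (fw_restrict A {x \<in> topspace (fst A). \<mu> x < 2}) (G n) X (p n) id"
    "fw_lifts (fw_restrict A {x \<in> topspace (fst A). -1 < \<mu> x}) E X f id"
  have "fw_space B A" unfolding A by (rule fw_space_restrict[OF X])
  then show "fw_lifts A (G (Suc n)) X (p (Suc n)) id"
    unfolding ganea_join_eq[OF ganea_joinable]
    by (rule fw_joinable.fw_lifts_join_glue[OF ganea_joinable _ L])
qed

end

section \<open>Fibrewise products\<close>

lemma topspace_fw_power:
  "xs \<in> topspace (fst (fw_power n X)) \<longleftrightarrow> xs \<in> extensional {..<n} \<and> (\<forall>i<n. xs i \<in> topspace (fst X)) \<and>
    (\<forall>i<n. \<forall>j<n. snd X (xs i) = snd X (xs j))"
  unfolding fw_power_def fst_conv topspace_subtopology topspace_product_topology PiE_iff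
    Int_iff mem_Collect_eq Ball_def lessThan_iff
  by iprover

lemma snd_fw_power [simp]: "snd (fw_power n X) xs = snd X (xs 0)"
  by (simp add: fw_power_def)

lemma continuous_map_fw_power:
  "continuous_map T (fst (fw_power n X)) F \<longleftrightarrow>
    (\<forall>i<n. continuous_map T (fst X) (\<lambda>a. F a i)) \<and>
    (\<forall>a\<in>topspace T. F a \<in> extensional {..<n} \<and> (\<forall>i<n. \<forall>j<n. snd X (F a i) = snd X (F a j)))"
  unfolding fw_power_def fst_conv continuous_map_in_subtopology continuous_map_componentwise
    Pi_iff image_subset_iff mem_Collect_eq ball_conj_distrib Ball_def lessThan_iff
  by iprover

lemma continuous_map_fw_prod:
  "continuous_map T (fst (fw_prod X Y)) (\<lambda>a. (F a, H a)) \<longleftrightarrow>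
    continuous_map T (fst X) F \<and> continuous_map T (fst Y) H \<and> (\<forall>a\<in>topspace T. snd X (F a) = snd Y (H a))"
  by (auto simp: fw_prod_def continuous_map_in_subtopology continuous_map_paired)

lemma topspace_fw_prod:
  "(x,y) \<in> topspace (fst (fw_prod X Y)) \<longleftrightarrow> x \<in> topspace (fst X) \<and> y \<in> topspace (fst Y) \<and> snd X x = snd Y y"
  by (auto simp: fw_prod_def)

lemma fw_map_fst: "fw_map (fw_prod X Y) X fst"
  and fw_map_snd: "fw_map (fw_prod X Y) Y snd"
  by (auto simp: fw_map_def fw_prod_def intro: continuous_map_from_subtopology continuous_map_fst continuous_map_snd)

lemma fw_space_prod:
  assumes "fw_space B X" shows "fw_space B (fw_prod X Y)"
proof -
  have "continuous_map (fst (fw_prod X Y)) B (\<lambda>a. snd X (fst a))"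
    using fw_map_fst[of X Y] assms by - (rule continuous_map_comp2[of _ "fst X" fst], auto simp: fw_map_def fw_space_def)
  then show ?thesis by (simp add: fw_space_def fw_prod_def case_prod_unfold)
qed

lemma fw_cons_simps [simp]: "fw_cons n x xs 0 = x" "i < n \<Longrightarrow> fw_cons n x xs (Suc i) = xs i"
  by (auto simp: fw_cons_def)

lemma fw_diag_simps [simp]: "i < n \<Longrightarrow> fw_diag n x i = x"
  by (simp add: fw_diag_def)

lemma fw_diag_Suc: "fw_diag (Suc n) x = fw_cons n x (fw_diag n x)"
  by (rule ext) (auto simp: fw_diag_def fw_cons_def)

text \<open>Left inverse of \<open>fw_cons\<close> in its second argument, on extensional
  families.\<close>

definition fw_tail :: "nat \<Rightarrow> (nat \<Rightarrow> 'x) \<Rightarrow> (nat \<Rightarrow> 'x)" where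
  "fw_tail n xs = (\<lambda>i\<in>{..<n}. xs (Suc i))"

lemma fw_tail_cons: "xs \<in> extensional {..<n} \<Longrightarrow> fw_tail n (fw_cons n x xs) = xs"
  by (rule ext) (auto simp: fw_tail_def extensional_def)

lemma fw_tail_diag: "fw_tail n (fw_diag (Suc n) x) = fw_diag n x"
  by (rule ext) (auto simp: fw_tail_def fw_diag_def)

lemma continuous_map_fw_power_proj:
  "i < n \<Longrightarrow> continuous_map (fst (fw_power n X)) (fst X) (\<lambda>xs. xs i)"
  unfolding fw_power_def fst_conv
  using continuous_map_product_projection[of i "{..<n}" "\<lambda>_. fst X"]
  by (intro continuous_map_from_subtopology) simp

lemma fw_map_head: "fw_map (fw_power (Suc n) X) X (\<lambda>xs. xs 0)"
  by (simp add: fw_map_def continuous_map_fw_power_proj)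

text \<open>The base point is read off coordinate 0, which the tail drops; as all coordinates lie in
  one fibre, the new coordinate 0 gives the same base point.\<close>

lemma fw_map_tail: "fw_map (fw_power (Suc (Suc n)) X) (fw_power (Suc n) X) (fw_tail (Suc n))"
proof -
  have eq: "snd X (xs i) = snd X (xs k)"
    if "xs \<in> topspace (fst (fw_power (Suc (Suc n)) X))" "i < Suc (Suc n)" "k < Suc (Suc n)" for xs i k
    using that unfolding topspace_fw_power by blast
  have tail: "fw_tail (Suc n) xs i = xs (Suc i)" if "i < Suc n" for xs :: "nat \<Rightarrow> 'a" and i
    using that by (simp add: fw_tail_def)
  have "continuous_map (fst (fw_power (Suc (Suc n)) X)) (fst (fw_power (Suc n) X)) (fw_tail (Suc n))"
    unfolding continuous_map_fw_power
  proof (intro conjI allI impI ballI)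
    show "continuous_map (fst (fw_power (Suc (Suc n)) X)) (fst X) (\<lambda>xs. fw_tail (Suc n) xs i)" if "i < Suc n" for i
      using that by (simp add: tail continuous_map_fw_power_proj)
  next
    fix xs i k assume "xs \<in> topspace (fst (fw_power (Suc (Suc n)) X))" "i < Suc n" "k < Suc n"
    then show "snd X (fw_tail (Suc n) xs i) = snd X (fw_tail (Suc n) xs k)"
      unfolding tail[OF \<open>i < Suc n\<close>] tail[OF \<open>k < Suc n\<close>] by (intro eq) auto
  qed (simp add: fw_tail_def)
  moreover have "snd X (fw_tail (Suc n) xs 0) = snd X (xs 0)"
    if "xs \<in> topspace (fst (fw_power (Suc (Suc n)) X))" for xs
    unfolding tail[OF zero_less_Suc] by (rule eq[OF that]) auto
  ultimately show ?thesis by (simp add: fw_map_def)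
qed

lemma fw_map_diag: "fw_map X (fw_power (Suc n) X) (fw_diag (Suc n))"
proof -
  have "continuous_map (fst X) (fst (fw_power (Suc n) X)) (fw_diag (Suc n))"
    using fw_map_id[of X] unfolding continuous_map_fw_power by (auto simp: fw_diag_def fw_map_def)
  then show ?thesis by (simp add: fw_map_def)
qed

lemma continuous_map_fw_cons:
  assumes x: "continuous_map T (fst X) x" and xs: "continuous_map T (fst (fw_power (Suc n) X)) xs"
    and eq: "\<And>a. a \<in> topspace T \<Longrightarrow> snd X (x a) = snd X (xs a 0)"
  shows "continuous_map T (fst (fw_power (Suc (Suc n)) X)) (\<lambda>a. fw_cons (Suc n) (x a) (xs a))"
  unfolding continuous_map_fw_power
proof (intro conjI allI impI ballI)
  have "continuous_map T (fst X) (\<lambda>a. xs a i)" if "i < Suc n" for i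
    using xs that unfolding continuous_map_fw_power by blast
  then show "continuous_map T (fst X) (\<lambda>a. fw_cons (Suc n) (x a) (xs a) i)" if "i < Suc (Suc n)" for i
    using x that by (cases i) simp_all
next
  fix a assume a: "a \<in> topspace T"
  show "fw_cons (Suc n) (x a) (xs a) \<in> extensional {..<Suc (Suc n)}" by (simp add: fw_cons_def)
  \<comment> \<open>Old coordinates are compared with the new first one through the old coordinate
    0.\<close>
  have *: "snd X (fw_cons (Suc n) (x a) (xs a) i) = snd X (x a)" if "i < Suc (Suc n)" for i
  proof (cases i)
    case (Suc k)
    then have "snd X (xs a k) = snd X (xs a 0)"
      using that xs a unfolding continuous_map_fw_power by blast
    then show ?thesis using Suc that eq[OF a] by simp
  qed simp
  show "snd X (fw_cons (Suc n) (x a) (xs a) i) = snd X (fw_cons (Suc n) (x a) (xs a) j)"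
    if "i < Suc (Suc n)" "j < Suc (Suc n)" for i j using * that by simp
qed

text \<open>Covers both maps whose join is the next fat wedge: \<open>u\<close> and \<open>v\<close>
  are \<open>f\<close> and the identity in one case, the identity and \<open>j n\<close> in the
  other.\<close>

lemma fw_map_cons_prod:
  assumes u: "fw_map Y X u" and v: "fw_map Z (fw_power (Suc n) X) v"
  shows "fw_map (fw_prod Y Z) (fw_power (Suc (Suc n)) X) (\<lambda>(y,z). fw_cons (Suc n) (u y) (v z))"
proof -
  have "continuous_map (fst (fw_prod Y Z)) (fst (fw_power (Suc (Suc n)) X)) (\<lambda>a. fw_cons (Suc n) (u (fst a)) (v (snd a)))"
  proof (rule continuous_map_fw_cons)
    show "continuous_map (fst (fw_prod Y Z)) (fst X) (\<lambda>a. u (fst a))"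
      using fw_map_fst[of Y Z] u by - (rule continuous_map_comp2[of _ "fst Y" fst], auto simp: fw_map_def)
    show "continuous_map (fst (fw_prod Y Z)) (fst (fw_power (Suc n) X)) (\<lambda>a. v (snd a))"
      using fw_map_snd[of Y Z] v by - (rule continuous_map_comp2[of _ "fst Z" snd], auto simp: fw_map_def)
    fix a assume "a \<in> topspace (fst (fw_prod Y Z))"
    then have a: "fst a \<in> topspace (fst Y)" "snd a \<in> topspace (fst Z)" "snd Y (fst a) = snd Z (snd a)"
      by (auto simp: fw_prod_def)
    have "snd (fw_power (Suc n) X) (v (snd a)) = snd X (u (fst a))"
      using a u v unfolding fw_map_def by simp
    then show "snd X (u (fst a)) = snd X (v (snd a) 0)" by (simp add: fw_power_def)
  qed
  moreover have "snd (fw_power (Suc (Suc n)) X) (fw_cons (Suc n) (u y) (v z)) = snd (fw_prod Y Z) (y,z)"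
    if "(y,z) \<in> topspace (fst (fw_prod Y Z))" for y z
    using that u by (simp add: topspace_fw_prod fw_map_def) (simp add: fw_prod_def)
  ultimately show ?thesis unfolding fw_map_def split_beta by force
qed

section \<open>Fat wedges\<close>

text \<open>Both homotopies run simultaneously, one in the first coordinate and one in the rest; the
  diagonal is its first coordinate followed by the shorter diagonal.\<close>

lemma fw_lifts_diag_cons:
  assumes L: "fw_lift A Y X u id \<phi> H"
    and M: "fw_lift A Z (fw_power (Suc n) X) v (fw_diag (Suc n)) \<psi> N"
  shows "fw_lifts A (fw_prod Y Z) (fw_power (Suc (Suc n)) X) (\<lambda>(y,z). fw_cons (Suc n) (u y) (v z)) (fw_diag (Suc (Suc n)))"
proof -
  note H = fw_liftD[OF L] and N = fw_liftD[OF M]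
  have "fw_map A (fw_prod Y Z) (\<lambda>x. (\<phi> x, \<psi> x))"
    unfolding fw_map_def continuous_map_fw_prod using H(1,2) N(1,2) by (auto simp: fw_prod_def)
  moreover have "continuous_map (prod_topology I01 (fst A)) (fst (fw_power (Suc (Suc n)) X)) (\<lambda>p. fw_cons (Suc n) (H p) (N p))"
  proof (rule continuous_map_fw_cons[OF H(3) N(3)])
    fix p assume "p \<in> topspace (prod_topology I01 (fst A))"
    then show "snd X (H p) = snd X (N p 0)" using H(6)[of "fst p" "snd p"] N(6)[of "fst p" "snd p"]
      by (auto simp: fw_power_def)
  qed
  ultimately have "fw_lift A (fw_prod Y Z) (fw_power (Suc (Suc n)) X) (\<lambda>(y,z). fw_cons (Suc n) (u y) (v z))
      (fw_diag (Suc (Suc n))) (\<lambda>x. (\<phi> x, \<psi> x)) (\<lambda>p. fw_cons (Suc n) (H p) (N p))"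
    unfolding fw_lift_def
  proof (intro conjI ballI)
    fix x assume x: "x \<in> topspace (fst A)"
    show "fw_cons (Suc n) (H (0, x)) (N (0, x)) = (case (\<phi> x, \<psi> x) of (y,z) \<Rightarrow> fw_cons (Suc n) (u y) (v z))"
      using H(4)[OF x] N(4)[OF x] by simp
    show "fw_cons (Suc n) (H (1, x)) (N (1, x)) = fw_diag (Suc (Suc n)) x"
      using H(5)[OF x] N(5)[OF x] fw_diag_Suc[of "Suc n" x] by simp
    fix t :: real assume "t \<in> {0..1}"
    then show "snd (fw_power (Suc (Suc n)) X) (fw_cons (Suc n) (H (t, x)) (N (t, x))) = snd A x"
      using H(6)[of t x] x by (simp add: fw_power_def)
  qed auto
  then show ?thesis unfolding fw_lifts_iff by blast
qed

text \<open>The constant homotopy supplies the lift for the factor on which the map to the power is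
  the identity.\<close>

lemma fw_lift_refl:
  assumes "fw_map X K g" and "A = fw_restrict X W"
  shows "fw_lift A K K (\<lambda>y. y) g g (\<lambda>p. g (snd p))"
proof -
  have "continuous_map (fst A) (fst K) g"
    using assms by (auto simp: fw_map_def continuous_map_from_subtopology)
  from this continuous_map_comp2[OF continuous_map_snd this]
  show ?thesis using assms by (simp add: fw_lift_def fw_map_def)
qed

context fw_setting
begin

abbreviation "T \<equiv> fatwedge_space B E X f"
abbreviation "j \<equiv> fatwedge_map B E X f"
abbreviation "P \<equiv> \<lambda>n. fw_power (Suc n) X"
abbreviation "hE \<equiv> \<lambda>n (e, xs). fw_cons (Suc n) (f e) xs"
abbreviation "hT \<equiv> \<lambda>n (x, w). fw_cons (Suc n) x (j n w)"
abbreviation "wedge_joinable \<equiv> \<lambda>n. fw_joinable B (fw_prod E (P n)) (fw_prod X (T n)) (P (Suc n)) (hE n) (hT n) WL WR WM"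

lemma fw_map_hE: "fw_map (fw_prod E (P n)) (P (Suc n)) (hE n)"
  using fw_map_cons_prod[OF f fw_map_id[of "P n"]] .

lemma fw_map_hT: "fw_map (T n) (P n) (j n) \<Longrightarrow> fw_map (fw_prod X (T n)) (P (Suc n)) (hT n)"
  using fw_map_cons_prod[OF fw_map_id[of X]] .

lemma fatwedge_joinable_step: "fw_map (T n) (P n) (j n) \<Longrightarrow> wedge_joinable n"
  by (rule fw_joinable.intro[OF fw_space_prod[OF E] fw_space_prod[OF X] fw_map_hE fw_map_hT]) simp_all

lemma fatwedge_Suc:
  "fw_fatwedge B E X f (Suc n)
    = fw_join B (fw_prod E (P n)) (fw_prod X (T n)) (P (Suc n)) (hE n) (hT n) WL WR WM"
  by (simp add: fatwedge_space_def fatwedge_map_def split_beta)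

lemma fatwedge_join_eq:
  assumes "wedge_joinable n"
  shows "T (Suc n) = (fw_joinable.J B (fw_prod E (P n)) (fw_prod X (T n)) (P (Suc n)) (hE n) (hT n) WL WR WM,
      fw_joinable.pJ B (fw_prod E (P n)) (fw_prod X (T n)) (P (Suc n)) (hE n) (hT n) WL WR WM)"
    and "j (Suc n) = fw_joinable.jJ B (fw_prod E (P n)) (fw_prod X (T n)) (P (Suc n)) (hE n) (hT n) WL WR WM"
  unfolding fatwedge_space_def[of B E X f "Suc n"] fatwedge_map_def[of B E X f "Suc n"] fatwedge_Suc
    fw_joinable.J_def[OF assms] fw_joinable.pJ_def[OF assms] fw_joinable.jJ_def[OF assms] by auto

lemma fatwedge_0:
  "T 0 = (final_top (fst E) W0, \<lambda>u. case u of W0 e \<Rightarrow> snd E e | _ \<Rightarrow> undefined)"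
  "j 0 = (\<lambda>u. case u of W0 e \<Rightarrow> fw_diag (Suc 0) (f e) | _ \<Rightarrow> undefined)"
  unfolding fatwedge_space_def fatwedge_map_def fw_fatwedge.simps fw_diag_def One_nat_def by simp_all

lemma fatwedge_fw: "fw_map (T n) (P n) (j n)"
proof (induction n)
  case 0
  have d: "fw_map X (P 0) (fw_diag (Suc 0))" by (rule fw_map_diag)
  have "continuous_map (fst E) (fst (P 0)) (\<lambda>e. fw_diag (Suc 0) (f e))"
    by (rule continuous_map_comp2[of _ "fst X" f]) (use d f in \<open>auto simp: fw_map_def\<close>)
  then have "continuous_map (final_top (fst E) W0) (fst (P 0))
      (\<lambda>u. case u of W0 e \<Rightarrow> fw_diag (Suc 0) (f e) | _ \<Rightarrow> undefined)"
    by (intro continuous_map_from_final_top) simp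
  then show ?case
    using f unfolding fatwedge_0 by (auto simp: fw_map_def topspace_final_top)
next
  case (Suc n)
  then have J: "wedge_joinable n" by (rule fatwedge_joinable_step)
  show ?case unfolding fatwedge_join_eq[OF J] by (rule fw_joinable.fw_map_join[OF J])
qed

lemma fatwedge_joinable: "wedge_joinable n"
  by (rule fatwedge_joinable_step[OF fatwedge_fw])

text \<open>The diagonal and the head projection identify \<open>X\<close> with its first power,
  which turns lifts of the 1-fold diagonal into lifts of the identity.\<close>

lemma fatwedge_lifts_0: "fw_lifts A (T 0) (P 0) (j 0) (fw_diag (Suc 0)) \<longleftrightarrow> fw_lifts A E X f id"
proof -
  have "fw_lifts A (T 0) (P 0) (j 0) (fw_diag (Suc 0))
      \<longleftrightarrow> fw_lifts A E (P 0) (\<lambda>e. fw_diag (Suc 0) (f e)) (fw_diag (Suc 0))"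
    unfolding fatwedge_0
    by (subst fw_lifts_final_top) (auto simp: inj_def)
  also have "\<dots> \<longleftrightarrow> fw_lifts A E X f id"
  proof
    show "fw_lifts A E (P 0) (\<lambda>e. fw_diag (Suc 0) (f e)) (fw_diag (Suc 0)) \<Longrightarrow> fw_lifts A E X f id"
      by (erule fw_lifts_map[OF _ fw_map_id fw_map_head]) auto
    show "fw_lifts A E X f id \<Longrightarrow> fw_lifts A E (P 0) (\<lambda>e. fw_diag (Suc 0) (f e)) (fw_diag (Suc 0))"
      by (erule fw_lifts_map[OF _ fw_map_id fw_map_diag]) auto
  qed
  finally show ?thesis .
qed

text \<open>One direction reads off the head coordinate; the other pairs a lift along
  \<open>f\<close> with the constant homotopy of the shorter diagonal.\<close>

lemma fw_lifts_hE:
  assumes A: "A = fw_restrict X W"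
  shows "fw_lifts A (fw_prod E (P n)) (P (Suc n)) (hE n) (fw_diag (Suc (Suc n))) \<longleftrightarrow> fw_lifts A E X f id"
proof
  show "fw_lifts A (fw_prod E (P n)) (P (Suc n)) (hE n) (fw_diag (Suc (Suc n))) \<Longrightarrow> fw_lifts A E X f id"
    by (erule fw_lifts_map[OF _ fw_map_fst fw_map_head]) (auto simp: split_beta)
  assume "fw_lifts A E X f id"
  then obtain \<phi> H where "fw_lift A E X f id \<phi> H" unfolding fw_lifts_iff by blast
  from fw_lifts_diag_cons[OF this fw_lift_refl[OF fw_map_diag A]]
  show "fw_lifts A (fw_prod E (P n)) (P (Suc n)) (hE n) (fw_diag (Suc (Suc n)))" .
qed

text \<open>Dropping the head coordinate recovers a lift along \<open>j n\<close>; conversely, the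
  head coordinate is lifted by the identity with a constant homotopy.\<close>

lemma fw_lifts_hT:
  assumes A: "A = fw_restrict X W"
  shows "fw_lifts A (fw_prod X (T n)) (P (Suc n)) (hT n) (fw_diag (Suc (Suc n)))
    \<longleftrightarrow> fw_lifts A (T n) (P n) (j n) (fw_diag (Suc n))"
proof
  have "fw_tail (Suc n) (fw_cons (Suc n) x (j n w)) = j n w" if "w \<in> topspace (fst (T n))" for x w
  proof (rule fw_tail_cons)
    have "j n w \<in> topspace (fst (P n))"
      using fatwedge_fw[of n] that continuous_map_image_subset_topspace unfolding fw_map_def by blast
    then show "j n w \<in> extensional {..<Suc n}" unfolding topspace_fw_power by blast
  qed
  then show "fw_lifts A (fw_prod X (T n)) (P (Suc n)) (hT n) (fw_diag (Suc (Suc n)))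
    \<Longrightarrow> fw_lifts A (T n) (P n) (j n) (fw_diag (Suc n))"
    by (elim fw_lifts_map[OF _ fw_map_snd fw_map_tail]) (auto simp: topspace_fw_prod fw_tail_diag)
  assume "fw_lifts A (T n) (P n) (j n) (fw_diag (Suc n))"
  then obtain \<phi> H where L: "fw_lift A (T n) (P n) (j n) (fw_diag (Suc n)) \<phi> H" unfolding fw_lifts_iff by blast
  have "fw_map X X id" using fw_map_id[of X] by (simp add: id_def)
  from fw_lifts_diag_cons[OF fw_lift_refl[OF this A] L]
  show "fw_lifts A (fw_prod X (T n)) (P (Suc n)) (hT n) (fw_diag (Suc (Suc n)))" .
qed

text \<open>The factor containing \<open>E\<close> comes first in this join, opposite to the order
  of the recursion, so the two pieces change places in splitting and in gluing.\<close>

theorem fw_secat_le_iff_fatwedge: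
  assumes "normal_space (fst X)"
  shows "fw_secat E X f \<le> enat n \<longleftrightarrow> fw_lifts X (T n) (P n) (j n) (fw_diag (Suc n))"
proof (rule fw_secat_le_iff_recursion[OF assms, where \<Lambda> = "\<lambda>n A. fw_lifts A (T n) (P n) (j n) (fw_diag (Suc n))"])
  show "fw_lifts (fw_restrict X W) (T 0) (P 0) (j 0) (fw_diag (Suc 0)) \<longleftrightarrow> fw_lifts (fw_restrict X W) E X f id" for W
    by (rule fatwedge_lifts_0)
  show "fw_lifts (fw_restrict X V) (T n) (P n) (j n) (fw_diag (Suc n))"
    if "fw_lifts (fw_restrict X W) (T n) (P n) (j n) (fw_diag (Suc n))" "V \<subseteq> W" for n V W
    using that by (rule fw_lifts_restrict_mono)
next
  fix n W and A :: "('x,'b) fws"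
  assume A: "A = fw_restrict X W" and "fw_lifts A (T (Suc n)) (P (Suc n)) (j (Suc n)) (fw_diag (Suc (Suc n)))"
  then obtain U V where UV: "openin (fst A) U" "openin (fst A) V" "U \<union> V = topspace (fst A)"
    "fw_lifts (fw_restrict A U) (fw_prod E (P n)) (P (Suc n)) (hE n) (fw_diag (Suc (Suc n)))"
    "fw_lifts (fw_restrict A V) (fw_prod X (T n)) (P (Suc n)) (hT n) (fw_diag (Suc (Suc n)))"
    unfolding fatwedge_join_eq[OF fatwedge_joinable]
    by (elim fw_joinable.fw_lifts_join_split[OF fatwedge_joinable])
  have r: "fw_restrict A Q = fw_restrict X (W \<inter> Q)" for Q using A by (simp add: subtopology_subtopology)
  have "fw_lifts (fw_restrict A U) E X f id" using UV(4) unfolding fw_lifts_hE[OF r] .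
  moreover have "fw_lifts (fw_restrict A V) (T n) (P n) (j n) (fw_diag (Suc n))"
    using UV(5) unfolding fw_lifts_hT[OF r] .
  moreover have "V \<union> U = topspace (fst A)" using UV(3) by (simp add: Un_commute)
  ultimately show "\<exists>U V. openin (fst A) U \<and> openin (fst A) V \<and> U \<union> V = topspace (fst A) \<and>
      fw_lifts (fw_restrict A U) (T n) (P n) (j n) (fw_diag (Suc n)) \<and> fw_lifts (fw_restrict A V) E X f id"
    using UV(1,2) by iprover
next
  fix n W and A :: "('x,'b) fws" and \<mu>
  assume A: "A = fw_restrict X W" and \<mu>: "continuous_map (fst A) euclideanreal \<mu>"
    and T: "fw_lifts (fw_restrict A {x \<in> topspace (fst A). \<mu> x < 2}) (T n) (P n) (j n) (fw_diag (Suc n))"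
    and E: "fw_lifts (fw_restrict A {x \<in> topspace (fst A). -1 < \<mu> x}) E X f id"
  have r: "fw_restrict A Q = fw_restrict X (W \<inter> Q)" for Q using A by (simp add: subtopology_subtopology)
  \<comment> \<open>Reflecting \<open>\<mu>\<close> in 1/2 exchanges the two conditions and so
    adapts the separating function to the order of the factors.\<close>
  have Q: "{x \<in> topspace (fst A). 1 - \<mu> x < 2} = {x \<in> topspace (fst A). -1 < \<mu> x}"
    "{x \<in> topspace (fst A). -1 < 1 - \<mu> x} = {x \<in> topspace (fst A). \<mu> x < 2}" by auto
  show "fw_lifts A (T (Suc n)) (P (Suc n)) (j (Suc n)) (fw_diag (Suc (Suc n)))"
    unfolding fatwedge_join_eq[OF fatwedge_joinable]
  proof (rule fw_joinable.fw_lifts_join_glue[OF fatwedge_joinable, where \<mu> = "\<lambda>x. 1 - \<mu> x"])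
    show "fw_space B A" unfolding A by (rule fw_space_restrict[OF X])
    show "continuous_map (fst A) euclideanreal (\<lambda>x. 1 - \<mu> x)" by (intro continuous_intros \<mu>)
    show "fw_lifts (fw_restrict A {x \<in> topspace (fst A). 1 - \<mu> x < 2}) (fw_prod E (P n)) (P (Suc n)) (hE n) (fw_diag (Suc (Suc n)))"
      unfolding Q fw_lifts_hE[OF r] by (rule E)
    show "fw_lifts (fw_restrict A {x \<in> topspace (fst A). -1 < 1 - \<mu> x}) (fw_prod X (T n)) (P (Suc n)) (hT n) (fw_diag (Suc (Suc n)))"
      unfolding Q fw_lifts_hT[OF r] by (rule T)
  qed
qed

end

section \<open>Equivalence of the covering, fat wedge and Ganea conditions\<close>

text \<open>Conditions (ii) and (iii) are instances of \<open>fw_lifts\<close> over the whole of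
  \<open>X\<close>; each is compared with (i), which also makes them equivalent to each
  other.\<close>

theorem theorem2p7:
  fixes B :: "'b topology" and E :: "'e topology" and X :: "'x topology"
    and pE :: "'e \<Rightarrow> 'b" and pX :: "'x \<Rightarrow> 'b" and f :: "'e \<Rightarrow> 'x" and n :: nat
  assumes "fw_space B (E, pE)" and "fw_space B (X, pX)"
    and "fw_map (E, pE) (X, pX) f"
    and "(normal_space E \<and> normal_space X) \<or>
         (closed_fw_cofibration B (E, pE) (X, pX) f \<and> normal_space X)"
  shows "(fw_secat (E, pE) (X, pX) f \<le> enat n \<longleftrightarrow>
           (\<exists>\<phi>. fw_map (X, pX) (fatwedge_space B (E, pE) (X, pX) f n) \<phi> \<and>
                fw_homotopic (X, pX) (fw_power (Suc n) (X, pX))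
                  (fatwedge_map B (E, pE) (X, pX) f n \<circ> \<phi>) (fw_diag (Suc n))))
       \<and> (fw_secat (E, pE) (X, pX) f \<le> enat n \<longleftrightarrow>
           (\<exists>\<sigma>. fw_map (X, pX) (ganea_space B (E, pE) (X, pX) f n) \<sigma> \<and>
                fw_homotopic (X, pX) (X, pX) (ganea_map B (E, pE) (X, pX) f n \<circ> \<sigma>) id))"
proof -
  interpret fw_setting B "(E, pE)" "(X, pX)" f
    by unfold_locales (use assms in auto)
  have X: "normal_space (fst (X, pX))" using assms(4) by auto
  show ?thesis
    using fw_secat_le_iff_fatwedge[OF X, of n] fw_secat_le_iff_ganea[OF X, of n]
    unfolding fw_lifts_def by (rule conjI)
qed

end
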